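(* There is an absolute constant $c$ such that for every $n\ge 4$, any two realizers of triangulations with $n$ vertices, i.e. any two vertices $R,R'$ of the colored flip graph $\mathcal{R}_n$, are at distance at most $c\,n^2$ in $\mathcal{R}_n$. That is, $R$ can be transformed into $R'$ by a sequence of $O(n^2)$ colored flips.
   Context: A triangulation is a maximal planar (simple) graph with a plane embedding and a fixed outer face with vertices $r_0,r_1,r_2$; all faces are triangles. Interior vertices/edges are those not on the outer face. Indices are modulo $3$. A realizer $R$ of a triangulation $T$ is a partition of its interior edges into three sets $T_0,T_1,T_2$ of directed edges such that for each interior vertex $u$: (1) $u$ has out-degree exactly one in each of $T_0,T_1,T_2$, and these outgoing edges appear in this counter-clockwise order around $u$; (2) all incoming edges of $T_i$ at $u$ occur between the outgoing edges of $T_{i+1}$ and $T_{i-1}$ of $u$ (in the sector not containing the outgoing edge of $T_i$). Each outer vertex is a sink, and $T_i$ is a tree directed towards its root $r_i$. An edge in $T_i$ is said to have label (color) $i$. The notation $\vec{uv}$ means the edge $uv$ oriented from $u$ to $v$. Let $uv$ be an interior edge of $T$ whose two incident faces form the quadrilateral $uwvz$. The edge $uv$ is flippable if $wz$ is not an edge of $T$; the diagonal flip of $uv$ replaces $uv$ by $wz$. Colored flips: let $R$ be a realizer of $T$, let $\vec{uv}$ be a flippable edge of label $i$, the diagonal of the quadrilateral $uwvz$, and suppose $\vec{wu}$ is an edge of $R$, with label $j$. The colored flip of $\vec{uv}$ with respect to $\vec{wu}$ replaces $\vec{uv}\in T_i$ by $\vec{uw}\in T_i$ and $\vec{wu}\in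 T_j$ by $\vec{wz}\in T_j$ (so the underlying triangulation undergoes the diagonal flip of $uv$), the result being again a realizer. It is of type $f_1^i$ if $j=i-1$ and of type $f_2^i$ if $j=i+1$ (modulo $3$). The roles of $w$ and $z$ may be exchanged. The colored flip graph $\mathcal{R}_n$ has as vertices all distinct realizers of all triangulations with $n$ vertices with outer vertices $r_0,r_1,r_2$; two realizers are adjacent if one can be transformed into the other by exactly one colored flip. Interior vertices are unlabelled: triangulations and realizers are considered up to isomorphism of plane graphs fixing $r_0,r_1,r_2$ and preserving edge orientations and colors. *)

theory Defs
  imports "HOL-Combinatorics.Orbits" "HOL-Library.Numeral_Type" "HOL-Library.Extended_Nat"
begin

text \<open>
  A finite simple graph with a plane embedding is given by a rotation system: every undirected
  edge is a pair of opposite darts, and \<open>rot G v w\<close> is the neighbour of \<open>v\<close> that follows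
  \<open>w\<close> in counter-clockwise order around \<open>v\<close>. Its values at non-neighbours are irrelevant.
\<close>

record 'v plane_map =
  verts :: "'v set"
  darts :: "('v \<times> 'v) set"
  rot :: "'v \<Rightarrow> 'v \<Rightarrow> 'v"

definition neighbours :: "('v, 'm) plane_map_scheme \<Rightarrow> 'v \<Rightarrow> 'v set" where
  "neighbours G v = {w. (v, w) \<in> darts G}"

definition edges :: "('v, 'm) plane_map_scheme \<Rightarrow> 'v set set" where
  "edges G = {{u, v} | u v. (u, v) \<in> darts G}"

definition rotation_system :: "('v, 'm) plane_map_scheme \<Rightarrow> bool" where
  "rotation_system G \<longleftrightarrow>
     finite (verts G) \<and> darts G \<subseteq> verts G \<times> verts G \<and> sym (darts G) \<and> irrefl (darts G) \<and>
     (\<forall>v\<in>verts G. neighbours G v \<noteq> {} \<longrightarrow> cyclic_on (rot G v) (neighbours G v))"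

text \<open>
  With counter-clockwise rotations, \<open>face_next G\<close> follows the boundary of the face on the
  right-hand side of a dart. A face is the set of darts on its boundary walk.
\<close>

definition face_next :: "('v, 'm) plane_map_scheme \<Rightarrow> 'v \<times> 'v \<Rightarrow> 'v \<times> 'v" where
  "face_next G d = (snd d, rot G (snd d) (fst d))"

definition faces :: "('v, 'm) plane_map_scheme \<Rightarrow> ('v \<times> 'v) set set" where
  "faces G = orbit (face_next G) ` darts G"

definition connected_map :: "('v, 'm) plane_map_scheme \<Rightarrow> bool" where
  "connected_map G \<longleftrightarrow> (\<forall>u\<in>verts G. \<forall>v\<in>verts G. (u, v) \<in> (darts G)\<^sup>*)"

text \<open>
  A connected rotation system describes an embedding into the sphere iff Euler's formula holds.
  (The one-vertex graph, whose only face has no darts, is not covered by this count.)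
\<close>

definition plane_graph :: "('v, 'm) plane_map_scheme \<Rightarrow> bool" where
  "plane_graph G \<longleftrightarrow> rotation_system G \<and> connected_map G \<and>
     card (verts G) + card (faces G) = card (edges G) + 2"

record 'v outer_map = "'v plane_map" +
  root :: "3 \<Rightarrow> 'v"

text \<open>
  Indices modulo 3 are elements of the type \<open>3\<close>. The outer face is the face whose vertices are
  the roots; for a triangulation with a realizer and at least four vertices, the order of the
  outgoing edges forces the roots to appear on it in counter-clockwise order. Maximality of the
  underlying planar graph follows, see \<open>triangulation_maximal_planar\<close> below.
\<close>

definition triangulation :: "'v outer_map \<Rightarrow> bool" where
  "triangulation T \<longleftrightarrow> plane_graph T \<and> card (verts T) \<ge> 3 \<and>
     (\<forall>F\<in>faces T. card F = 3) \<and> (\<exists>F\<in>faces T. fst ` F = range (root T))"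

definition inner_verts :: "'v outer_map \<Rightarrow> 'v set" where
  "inner_verts T = verts T - range (root T)"

definition inner_edges :: "'v outer_map \<Rightarrow> 'v set set" where
  "inner_edges T = {e \<in> edges T. \<not> e \<subseteq> range (root T)}"

text \<open>
  Going counter-clockwise around \<open>u\<close> from its neighbour \<open>a\<close>, one meets \<open>b\<close> before \<open>c\<close>;
  the three neighbours are distinct.
\<close>

definition ccw :: "('v, 'm) plane_map_scheme \<Rightarrow> 'v \<Rightarrow> 'v \<Rightarrow> 'v \<Rightarrow> 'v \<Rightarrow> bool" where
  "ccw G u a b c \<longleftrightarrow>
     0 < funpow_dist (rot G u) a b \<and> funpow_dist (rot G u) a b < funpow_dist (rot G u) a c"

definition directed_partition :: "'v set set \<Rightarrow> (3 \<Rightarrow> ('v \<times> 'v) set) \<Rightarrow> bool" where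
  "directed_partition E R \<longleftrightarrow>
     (\<forall>i x y. (x, y) \<in> R i \<longrightarrow> {x, y} \<in> E) \<and>
     (\<forall>e\<in>E. \<exists>!(i, x, y). (x, y) \<in> R i \<and> {x, y} = e)"

definition tree_towards :: "('v \<times> 'v) set \<Rightarrow> 'v \<Rightarrow> bool" where
  "tree_towards E r \<longleftrightarrow>
     single_valued E \<and> r \<notin> Domain E \<and> (\<forall>v\<in>Field E. (v, r) \<in> E\<^sup>*)"

text \<open>
  \<open>R i\<close> is the set of edges of label \<open>i\<close>, and \<open>out i\<close> is the head of the outgoing edge of
  label \<open>i\<close> of \<open>u\<close>.
\<close>

definition realizer :: "'v outer_map \<Rightarrow> (3 \<Rightarrow> ('v \<times> 'v) set) \<Rightarrow> bool" where
  "realizer T R \<longleftrightarrow>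
     directed_partition (inner_edges T) R \<and>
     (\<forall>u\<in>inner_verts T. \<exists>out. (\<forall>i v. (u, v) \<in> R i \<longleftrightarrow> v = out i) \<and>
        ccw T u (out 0) (out 1) (out 2) \<and>
        (\<forall>i x. (x, u) \<in> R i \<longrightarrow> ccw T u (out (i + 1)) x (out (i - 1)))) \<and>
     (\<forall>k i. root T k \<notin> Domain (R i)) \<and>
     (\<forall>i. tree_towards (R i) (root T i))"

type_synonym 'v realized = "'v outer_map \<times> (3 \<Rightarrow> ('v \<times> 'v) set)"

text \<open>
  \<open>w\<close>, \<open>v\<close>, \<open>z\<close> are consecutive neighbours of \<open>u\<close> in counter-clockwise order, so \<open>u w v z\<close> is the
  quadrilateral formed by the two faces at the edge \<open>uv\<close>.
\<close>

definition quadrilateral :: "('v, 'm) plane_map_scheme \<Rightarrow> 'v \<Rightarrow> 'v \<Rightarrow> 'v \<Rightarrow> 'v \<Rightarrow> bool" where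
  "quadrilateral G u w v z \<longleftrightarrow>
     {(u, w), (u, v), (u, z)} \<subseteq> darts G \<and> rot G u w = v \<and> rot G u v = z"

text \<open>
  Replaces the diagonal \<open>uv\<close> of the quadrilateral by \<open>wz\<close>, assuming
  \<open>quadrilateral T u w v z\<close> (which fixes the position of the new darts in the rotations).
\<close>

definition diagonal_flip :: "'v outer_map \<Rightarrow> 'v \<Rightarrow> 'v \<Rightarrow> 'v \<Rightarrow> 'v \<Rightarrow> 'v outer_map" where
  "diagonal_flip T u w v z = T\<lparr>
     darts := darts T - {(u, v), (v, u)} \<union> {(w, z), (z, w)},
     rot := (rot T)(
       u := (rot T u)(w := z),
       v := (rot T v)(z := w),
       w := (rot T w)(v := z, z := u),
       z := (rot T z)(u := w, w := v))\<rparr>"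

text \<open>
  The colored flip of the edge \<open>uv\<close> of label \<open>i\<close> with respect to the edge \<open>wu\<close> of label \<open>j\<close>;
  \<open>w\<close> may lie on either side of \<open>uv\<close>. The flip has type \<open>f\<^sub>1\<close> if \<open>j = i - 1\<close> and
  \<open>f\<^sub>2\<close> if \<open>j = i + 1\<close>.
\<close>

definition colored_flip :: "'v realized \<Rightarrow> 'v realized \<Rightarrow> bool" where
  "colored_flip P P' \<longleftrightarrow> (case (P, P') of ((T, R), (T', R')) \<Rightarrow>
     realizer T R \<and> realizer T' R' \<and>
     (\<exists>u v w z i j.
        (u, v) \<in> R i \<and> (w, u) \<in> R j \<and> (j = i - 1 \<or> j = i + 1) \<and> (w, z) \<notin> darts T \<and>
        (quadrilateral T u w v z \<and> T' = diagonal_flip T u w v z \<or>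
         quadrilateral T u z v w \<and> T' = diagonal_flip T u z v w) \<and>
        R' = R(i := R i - {(u, v)} \<union> {(u, w)}, j := R j - {(w, u)} \<union> {(w, z)})))"

definition realizer_set :: "nat \<Rightarrow> nat realized set" where
  "realizer_set n = {(T, R). triangulation T \<and> card (verts T) = n \<and> realizer T R}"

text \<open>
  Isomorphisms preserve the rotations (hence the embedding with its orientation), the roots,
  and the orientations and labels of the edges.
\<close>

definition realizer_iso :: "('v \<Rightarrow> 'w) \<Rightarrow> 'v realized \<Rightarrow> 'w realized \<Rightarrow> bool" where
  "realizer_iso f P P' \<longleftrightarrow> (case (P, P') of ((T, R), (T', R')) \<Rightarrow>
     bij_betw f (verts T) (verts T') \<and>
     (\<forall>x\<in>verts T. \<forall>y\<in>verts T. (f x, f y) \<in> darts T' \<longleftrightarrow> (x, y) \<in> darts T) \<and>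
     (\<forall>(x, y)\<in>darts T. f (rot T x y) = rot T' (f x) (f y)) \<and>
     (\<forall>i. f (root T i) = root T' i) \<and>
     (\<forall>x\<in>verts T. \<forall>y\<in>verts T. \<forall>i. (f x, f y) \<in> R' i \<longleftrightarrow> (x, y) \<in> R i))"

definition iso_rel :: "nat \<Rightarrow> (nat realized \<times> nat realized) set" where
  "iso_rel n = {(P, P') \<in> realizer_set n \<times> realizer_set n. \<exists>f. realizer_iso f P P'}"

text \<open>
  The colored flip graph: its vertices are the isomorphism classes of these pairs, and distances
  are infinite between different components.
\<close>

definition flip_graph_verts :: "nat \<Rightarrow> nat realized set set" where
  "flip_graph_verts n = realizer_set n // iso_rel n"

definition flip_graph_adj :: "nat \<Rightarrow> (nat realized set \<times> nat realized set) set" where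
  "flip_graph_adj n = {(X, Y) \<in> flip_graph_verts n \<times> flip_graph_verts n.
     \<exists>P\<in>X. \<exists>Q\<in>Y. colored_flip P Q \<or> colored_flip Q P}"

definition flip_dist :: "nat \<Rightarrow> nat realized set \<Rightarrow> nat realized set \<Rightarrow> enat" where
  "flip_dist n X Y = (INF k\<in>{k. (X, Y) \<in> flip_graph_adj n ^^ k}. enat k)"

text \<open>
  Two facts behind the definitions: triangulations are maximal planar graphs, and isomorphism
  is an equivalence relation.
\<close>

lemma rot_bij:
  assumes "rotation_system G" "(v, w) \<in> darts G"
  shows "(v, rot G v w) \<in> darts G" "inj_on (rot G v) (neighbours G v)"
proof -
  let ?N = "neighbours G v"
  have wN: "w \<in> ?N" and "v \<in> verts G" using assms
    by (auto simp: rotation_system_def neighbours_def)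
  then have cyc: "cyclic_on (rot G v) ?N"
    using assms(1) unfolding rotation_system_def by blast
  show "(v, rot G v w) \<in> darts G"
    using cyclic_on_inI[OF cyc wN] by (simp add: neighbours_def)
  have "?N \<subseteq> verts G" using assms(1) by (auto simp: rotation_system_def neighbours_def)
  then have fin: "finite ?N" using assms(1) finite_subset by (auto simp: rotation_system_def)
  have "rot G v ` ?N = ?N"
  proof
    show "rot G v ` ?N \<subseteq> ?N" using cyclic_on_inI[OF cyc] by blast
    show "?N \<subseteq> rot G v ` ?N"
    proof
      fix y assume y: "y \<in> ?N"
      then have "y \<in> orbit (rot G v) y" "orbit (rot G v) y = ?N"
        using cyc by (auto simp: cyclic_on_alldef)
      then show "y \<in> rot G v ` ?N" by (metis imageI orbit.cases y)
    qed
  qed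
  then show "inj_on (rot G v) ?N" using fin by (simp add: eq_card_imp_inj_on)
qed

lemma finite_darts: "rotation_system G \<Longrightarrow> finite (darts G)"
  unfolding rotation_system_def by (meson finite_SigmaI finite_subset)

lemma face_next_bij:
  assumes "rotation_system G" shows "bij_betw (face_next G) (darts G) (darts G)"
proof -
  have sub: "face_next G ` darts G \<subseteq> darts G"
    using assms rot_bij(1)[OF assms] unfolding rotation_system_def face_next_def
    by (auto dest: symD)
  have "inj_on (face_next G) (darts G)"
  proof (rule inj_onI, goal_cases)
    case (1 d e)
    obtain a b c where d: "d = (a, b)" "e = (c, b)" and eq: "rot G b a = rot G b c"
      using 1 by (cases d; cases e) (auto simp: face_next_def)
    have "(b, a) \<in> darts G" "(b, c) \<in> darts G"
      using 1 d assms unfolding rotation_system_def by (auto dest: symD)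
    then show ?case using rot_bij(2)[OF assms] eq d
      by (metis inj_onD mem_Collect_eq neighbours_def)
  qed
  then show ?thesis using sub finite_darts[OF assms]
    by (simp add: bij_betw_def endo_inj_surj)
qed

lemma face_orbit:
  assumes G: "rotation_system G" and d: "d \<in> darts G"
  shows "orbit (face_next G) d \<subseteq> darts G" "d \<in> orbit (face_next G) d"
    "e \<in> orbit (face_next G) d \<Longrightarrow> orbit (face_next G) e = orbit (face_next G) d"
proof -
  let ?p = "perm_restrict (face_next G) (darts G)"
  have p: "?p permutes darts G"
  proof (rule bij_imp_permutes)
    show "bij_betw ?p (darts G) (darts G)"
      using face_next_bij[OF G] by (simp add: perm_restrict_simps cong: bij_betw_cong)
  qed (simp add: perm_restrict_def)
  have eq: "orbit (face_next G) x = orbit ?p x" if "x \<in> darts G" for x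
    by (rule orbit_cong0[OF that])
      (use face_next_bij[OF G] in \<open>auto simp: perm_restrict_def bij_betw_def\<close>)
  have cyc: "cyclic_on ?p (orbit ?p d)"
    by (rule cyclic_on_orbit[OF p finite_darts[OF G]])
  show sub: "orbit (face_next G) d \<subseteq> darts G"
    using permutes_orbit_subset[OF p d] eq[OF d] by simp
  show "d \<in> orbit (face_next G) d"
    using p finite_darts[OF G] eq[OF d]
    by (metis permutation_permutes permutation_self_in_orbit)
  show "orbit (face_next G) e = orbit (face_next G) d" if e: "e \<in> orbit (face_next G) d"
    using orbit_cyclic_eq3[OF cyc, of e] e sub eq[OF d] eq[of e] by auto
qed

lemma sum_card_faces:
  assumes "rotation_system G" shows "(\<Sum>F\<in>faces G. card F) = card (darts G)"
proof -
  have U: "\<Union>(faces G) = darts G"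
    using face_orbit(1,2)[OF assms] unfolding faces_def by blast
  have "card (\<Union>(faces G)) = (\<Sum>F\<in>faces G. card F)"
  proof (rule card_Union_disjoint)
    show "pairwise disjnt (faces G)"
    proof (rule pairwiseI)
      fix A B assume AB: "A \<in> faces G" "B \<in> faces G" "A \<noteq> B"
      then obtain d d' where d: "d \<in> darts G" "A = orbit (face_next G) d"
        "d' \<in> darts G" "B = orbit (face_next G) d'"
        unfolding faces_def by blast
      have "e \<notin> B" if "e \<in> A" for e
        using face_orbit(3)[OF assms d(1), of e] face_orbit(3)[OF assms d(3), of e] d that AB(3)
        by metis
      then show "disjnt A B" unfolding disjnt_def by blast
    qed
    show "finite F" if "F \<in> faces G" for F
    proof -
      have "F \<subseteq> darts G" using that U by blast
      then show ?thesis using finite_darts[OF assms] by (rule finite_subset)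
    qed
  qed
  then show ?thesis using U by simp
qed

lemma card_darts:
  assumes "rotation_system G" shows "card (darts G) = 2 * card (edges G)"
proof -
  have sy: "sym (darts G)" and ir: "irrefl (darts G)"
    using assms by (auto simp: rotation_system_def)
  let ?D = "\<lambda>e. {d \<in> darts G. {fst d, snd d} = e}"
  have E: "edges G = (\<lambda>d. {fst d, snd d}) ` darts G" unfolding edges_def by force
  have c2: "card (?D e) = 2" if "e \<in> edges G" for e
  proof -
    from that obtain a b where e: "e = {a, b}" "(a, b) \<in> darts G" unfolding edges_def by auto
    have "a \<noteq> b" using e ir by (auto simp: irrefl_def)
    moreover have "?D e = {(a, b), (b, a)}"
    proof -
      have "(b, a) \<in> darts G" using e sy by (blast dest: symD)
      then show ?thesis using e by (auto simp: doubleton_eq_iff)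
    qed
    ultimately show ?thesis by simp
  qed
  have "card (darts G) = (\<Sum>e\<in>edges G. card (?D e))"
    unfolding E using sum.image_gen[OF finite_darts[OF assms], of "\<lambda>_. 1::nat" "\<lambda>d. {fst d, snd d}"]
    by simp
  then show ?thesis using c2 by simp
qed

lemma card_face_ge_3:
  assumes "plane_graph G" "card (verts G) \<ge> 3" "F \<in> faces G"
  shows "card F \<ge> 3"
proof -
  let ?f = "face_next G"
  have G: "rotation_system G" and con: "connected_map G"
    using assms by (auto simp: plane_graph_def)
  have sy: "sym (darts G)" and ir: "irrefl (darts G)" and fV: "finite (verts G)"
    and sub: "darts G \<subseteq> verts G \<times> verts G"
    using G by (auto simp: rotation_system_def)
  from assms(3) obtain a b where ab: "(a, b) \<in> darts G" and F: "F = orbit ?f (a, b)"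
    unfolding faces_def by auto
  define c where "c = rot G b a"
  have f1: "?f (a, b) = (b, c)" by (simp add: face_next_def c_def)
  have ba: "(b, a) \<in> darts G" using ab sy by (auto dest: symD)
  have bc: "(b, c) \<in> darts G" using rot_bij(1)[OF G ba] by (simp add: c_def)
  define e where "e = rot G c b"
  have f2: "?f (b, c) = (c, e)" by (simp add: face_next_def e_def)
  have ne: "a \<noteq> b" "b \<noteq> c" using ab bc ir by (auto simp: irrefl_def)
  have inF: "(a, b) \<in> F" "(b, c) \<in> F" "(c, e) \<in> F"
    unfolding F using face_orbit(2)[OF G ab] f1 f2 by (metis orbit.intros)+
  have "(c, e) \<noteq> (a, b)"
  proof
    assume "(c, e) = (a, b)"
    then have r: "rot G b a = a" "rot G a b = b" by (auto simp: c_def e_def)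
    have "neighbours G b = {a}" "neighbours G a = {b}"
    proof -
      have "cyclic_on (rot G b) (neighbours G b)" "cyclic_on (rot G a) (neighbours G a)"
        "a \<in> neighbours G b" "b \<in> neighbours G a"
        using G ab ba sub unfolding rotation_system_def neighbours_def by blast+
      then show "neighbours G b = {a}" "neighbours G a = {b}"
        using r by (metis orbit_cyclic_eq3 orbit_eq_singleton_iff)+
    qed
    then have step: "(x, y) \<in> darts G \<Longrightarrow> x \<in> {a, b} \<Longrightarrow> y \<in> {a, b}" for x y
      by (auto simp: neighbours_def)
    have "y \<in> {a, b}" if "(a, y) \<in> (darts G)\<^sup>*" for y
      using that by (induction rule: rtrancl_induct) (use step in blast)+
    then have "verts G \<subseteq> {a, b}"
      using con ab sub unfolding connected_map_def by blast
    then have "card (verts G) \<le> card {a, b}" by (simp add: card_mono)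
    then show False using assms(2) ne by simp
  qed
  moreover have "(c, e) \<noteq> (b, c)" "(a, b) \<noteq> (b, c)" using ne by auto
  ultimately have "card {(a, b), (b, c), (c, e)} = 3"
    by (simp add: card_insert_if del: Pair_inject prod.inject)
  moreover have "finite F"
    using face_orbit(1)[OF G ab] finite_darts[OF G] F finite_subset by metis
  ultimately show ?thesis using inF card_mono[of F "{(a, b), (b, c), (c, e)}"] by simp
qed

lemma card_edges_plane_graph:
  assumes "plane_graph G" "card (verts G) \<ge> 3"
  shows "card (edges G) + 6 \<le> 3 * card (verts G)"
proof -
  have G: "rotation_system G" and eu: "card (verts G) + card (faces G) = card (edges G) + 2"
    using assms by (auto simp: plane_graph_def)
  have "(\<Sum>F\<in>faces G. 3) \<le> (\<Sum>F\<in>faces G. card F)"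
    by (rule sum_mono) (rule card_face_ge_3[OF assms])
  then have "3 * card (faces G) \<le> 2 * card (edges G)"
    by (simp add: sum_card_faces[OF G] card_darts[OF G])
  then show ?thesis using eu by linarith
qed

lemma card_edges_triangulation:
  assumes "triangulation T"
  shows "card (edges T) + 6 = 3 * card (verts T)"
proof -
  have G: "rotation_system T" and eu: "card (verts T) + card (faces T) = card (edges T) + 2"
    and 3: "\<And>F. F \<in> faces T \<Longrightarrow> card F = 3"
    using assms by (auto simp: plane_graph_def triangulation_def)
  have "3 * card (faces T) = 2 * card (edges T)"
    using sum_card_faces[OF G] 3 by (simp add: card_darts[OF G])
  then show ?thesis using eu by linarith
qed

lemma triangulation_maximal_planar:
  fixes G :: "'v plane_map"
  assumes "triangulation T" "plane_graph G" "verts G = verts T" "darts T \<subseteq> darts G"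
  shows "darts G = darts T"
proof -
  have G: "rotation_system G" and T: "rotation_system T"
    using assms by (auto simp: plane_graph_def triangulation_def)
  have "card (edges G) \<le> card (edges T)"
    using card_edges_triangulation[OF assms(1)] card_edges_plane_graph[OF assms(2)] assms(1,3)
    by (simp add: triangulation_def)
  then have "card (darts G) \<le> card (darts T)"
    by (simp add: card_darts[OF G] card_darts[OF T])
  then show ?thesis using card_seteq[OF finite_darts[OF G] assms(4)] by simp
qed

lemma triangulation_props:
  assumes "triangulation T"
  shows "darts T \<subseteq> verts T \<times> verts T" "range (root T) \<subseteq> verts T"
    "(x, y) \<in> darts T \<Longrightarrow> rot T x y \<in> verts T"
proof -
  have G: "rotation_system T" using assms by (auto simp: plane_graph_def triangulation_def)
  then show D: "darts T \<subseteq> verts T \<times> verts T" by (simp add: rotation_system_def)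
  show "range (root T) \<subseteq> verts T"
  proof -
    obtain F where F: "F \<in> faces T" "fst ` F = range (root T)"
      using assms unfolding triangulation_def by blast
    have "F \<subseteq> verts T \<times> verts T"
      using F(1) face_orbit(1)[OF G] D unfolding faces_def by blast
    then show ?thesis unfolding F(2)[symmetric] by auto
  qed
  show "rot T x y \<in> verts T" if "(x, y) \<in> darts T"
    using rot_bij(1)[OF G that] D by blast
qed

lemma realizer_iso_refl: "realizer_iso id P P"
  by (cases P) (auto simp: realizer_iso_def)

lemma realizer_iso_inv:
  assumes "P \<in> realizer_set n" "P' \<in> realizer_set n" "realizer_iso f P P'"
  shows "realizer_iso (inv_into (verts (fst P)) f) P' P"
proof -
  obtain T R T' R' where P: "P = (T, R)" "P' = (T', R')" by (cases P; cases P')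
  have T: "triangulation T" "triangulation T'" using assms P by (auto simp: realizer_set_def)
  let ?g = "inv_into (verts T) f"
  have bij: "bij_betw f (verts T) (verts T')" and
    d: "\<And>x y. x \<in> verts T \<Longrightarrow> y \<in> verts T \<Longrightarrow> (f x, f y) \<in> darts T' \<longleftrightarrow> (x, y) \<in> darts T" and
    r: "\<And>x y. (x, y) \<in> darts T \<Longrightarrow> f (rot T x y) = rot T' (f x) (f y)" and
    o: "\<And>i. f (root T i) = root T' i" and
    l: "\<And>x y i. x \<in> verts T \<Longrightarrow> y \<in> verts T \<Longrightarrow> (f x, f y) \<in> R' i \<longleftrightarrow> (x, y) \<in> R i"
    using assms(3) unfolding P realizer_iso_def by auto
  have g: "?g x \<in> verts T" "f (?g x) = x" if "x \<in> verts T'" for x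
    using bij that by (auto simp: bij_betw_def inv_into_into f_inv_into_f)
  have gf: "?g (f x) = x" if "x \<in> verts T" for x
    using bij that by (simp add: bij_betw_def)
  have "?g (rot T' x y) = rot T (?g x) (?g y)" if xy: "(x, y) \<in> darts T'" for x y
  proof -
    have v: "x \<in> verts T'" "y \<in> verts T'" using xy triangulation_props(1)[OF T(2)] by auto
    then have "(?g x, ?g y) \<in> darts T" using d[of "?g x" "?g y"] g xy by simp
    then show ?thesis using r[of "?g x" "?g y"] g v gf triangulation_props(3)[OF T(1)] by metis
  qed
  moreover have "?g (root T' i) = root T i" for i
    using o[of i] gf triangulation_props(2)[OF T(1)] by (metis range_subsetD)
  moreover have "((?g x, ?g y) \<in> darts T \<longleftrightarrow> (x, y) \<in> darts T') \<and>
      ((?g x, ?g y) \<in> R i \<longleftrightarrow> (x, y) \<in> R' i)" if "x \<in> verts T'" "y \<in> verts T'" for x y i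
    using d[of "?g x" "?g y"] l[of "?g x" "?g y" i] g that by simp
  ultimately show ?thesis
    using bij_betw_inv_into[OF bij] unfolding P realizer_iso_def prod.case fst_conv by blast
qed

lemma realizer_iso_trans:
  assumes "P \<in> realizer_set n" "realizer_iso f P P'" "realizer_iso g P' P''"
  shows "realizer_iso (g \<circ> f) P P''"
proof -
  obtain T R T' R' T'' R'' where P: "P = (T, R)" "P' = (T', R')" "P'' = (T'', R'')"
    by (cases P; cases P'; cases P'')
  have D: "darts T \<subseteq> verts T \<times> verts T"
    using assms(1) P triangulation_props(1) by (auto simp: realizer_set_def)
  have f: "f x \<in> verts T'" if "x \<in> verts T" for x
    using assms(2) that unfolding P realizer_iso_def by (auto simp: bij_betw_def)
  have bij: "bij_betw (g \<circ> f) (verts T) (verts T'')"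
    using assms(2,3) unfolding P realizer_iso_def by (auto intro: bij_betw_trans)
  have rt: "(g \<circ> f) (root T i) = root T'' i" for i
    using assms(2,3) unfolding P realizer_iso_def by auto
  have dl: "(((g \<circ> f) x, (g \<circ> f) y) \<in> darts T'' \<longleftrightarrow> (x, y) \<in> darts T) \<and>
      (((g \<circ> f) x, (g \<circ> f) y) \<in> R'' i \<longleftrightarrow> (x, y) \<in> R i)"
    if "x \<in> verts T" "y \<in> verts T" for x y i
    using assms(2,3) f that unfolding P realizer_iso_def by auto
  have "(g \<circ> f) (rot T x y) = rot T'' ((g \<circ> f) x) ((g \<circ> f) y)" if xy: "(x, y) \<in> darts T" for x y
  proof -
    have v: "x \<in> verts T" "y \<in> verts T" using xy D by auto
    have "f (rot T x y) = rot T' (f x) (f y)" "(f x, f y) \<in> darts T'"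
      using assms(2) v xy unfolding P realizer_iso_def by auto
    then show ?thesis
      using assms(3) unfolding P realizer_iso_def by auto
  qed
  then show ?thesis
    using bij rt dl unfolding P realizer_iso_def prod.case by blast
qed

lemma equiv_iso_rel: "equiv (realizer_set n) (iso_rel n)"
proof (rule equivI)
  show "iso_rel n \<subseteq> realizer_set n \<times> realizer_set n"
    by (auto simp: iso_rel_def)
  show "refl_on (realizer_set n) (iso_rel n)"
    unfolding refl_on_def iso_rel_def using realizer_iso_refl by blast
  show "sym (iso_rel n)"
    unfolding iso_rel_def by (rule symI) (use realizer_iso_inv in blast)
  show "trans (iso_rel n)"
    unfolding iso_rel_def by (rule transI) (use realizer_iso_trans in blast)
qed

end

theory Submission
  imports Defs
begin

text \<open>
  Fix a label \<open>j\<close> and direct all edges upwards: those of label \<open>j\<close> along, the others against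
  their orientation. This relation is acyclic, so there are heights increasing along it. If
  \<open>w \<rightarrow> u\<close> has label \<open>j\<close>, \<open>u\<close> is an inner vertex and \<open>w\<close> immediately precedes the target \<open>v\<close> of the
  outgoing edge of label \<open>j - 1\<close> of \<open>u\<close>, then the colored flip of \<open>uv\<close> with respect to \<open>wu\<close> is
  always possible. It keeps the heights increasing, leaves label \<open>j + 1\<close> alone, and moves the
  target of the edge of label \<open>j\<close> from \<open>u\<close> to a higher vertex. Hence after at most \<open>n\<^sup>2\<close> flips
  all edges of label \<open>j\<close> end at \<open>root j\<close>. Doing this for \<open>j = 0\<close> and then for \<open>j = 2\<close>, which does
  not affect label \<open>0\<close>, reaches a realizer whose trees of labels \<open>0\<close> and \<open>2\<close> are stars. Its tree
  of label \<open>1\<close> is then a path, so it is unique up to isomorphism.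
\<close>

section \<open>Labels and cyclic orders\<close>

text \<open>Two things could stop a flip: \<open>w z\<close> may already be an edge, and the new
  trees must be acyclic, which is a global condition. Heights settle both. Since h w < h u < h z, an
  edge between \<open>w\<close> and \<open>z\<close> is impossible: whatever its label and
  direction, it would put \<open>z\<close> below \<open>u\<close>, unless it were the outgoing edge
  of label \<open>j\<close> of \<open>w\<close>, and that one is \<open>w u\<close>. The new edges,
  from \<open>w\<close> to \<open>z\<close> of label \<open>j\<close> and from \<open>u\<close> to
  \<open>w\<close> of label \<open>j - 1\<close>, agree with the old heights. So a single height
  function serves for a whole sweep, certifies acyclicity after every flip and bounds the number of
  flips. All other conditions are local. The cyclic order of the edges becomes a rule on which kinds
  of edges may follow each other, and Euler's formula becomes a count of darts, so the result of a
  flip can be checked corner by corner. The final constant is 4: two realizers, two sweeps for each,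
  at most \<open>n\<^sup>2\<close> flips per sweep.\<close>

lemma label_exhaust: "(i::3) = 0 \<or> i = 1 \<or> i = 2"
proof -
  have "card {0, 1, 2::3} = card (UNIV :: 3 set)" by simp
  then have "{0, 1, 2} = (UNIV :: 3 set)" by (intro card_subset_eq) auto
  then show ?thesis by blast
qed

lemma label_numerals: "(3::3) = 0" "- 1 = (2::3)" "- 2 = (1::3)"
  by (simp_all add: eq_neg_iff_add_eq_0 neg_eq_iff_add_eq_0)

lemma label_arith [simp]:
  "(i::3) + 1 + 1 = i - 1" "(i::3) - 1 - 1 = i + 1" "(i::3) + 1 \<noteq> i - 1" "(i::3) - 1 \<noteq> i + 1"
  using label_exhaust[of i] by auto

lemma label_cases: "(k::3) = i \<or> k = i + 1 \<or> k = i - 1"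
  using label_exhaust[of i] label_exhaust[of k] by auto

text \<open>Serves as induction around a vertex: what holds at one neighbour and passes on to the
  next holds at all of them.\<close>

lemma cyclic_on_closed:
  assumes "cyclic_on f N" "A \<subseteq> N" "a \<in> A" "\<And>x. x \<in> A \<Longrightarrow> f x \<in> A"
  shows "A = N"
proof -
  have "y \<in> A" if "y \<in> orbit f a" for y
    using that by induction (use assms in auto)
  then show ?thesis using orbit_cyclic_eq3[OF assms(1), of a] assms(2,3) by blast
qed

lemma cyclic_on_inj_on:
  assumes "cyclic_on f N" shows "inj_on f N"
proof -
  have "f ` N = N"
  proof (rule subset_antisym)
    show "f ` N \<subseteq> N" using cyclic_on_inI[OF assms] by blast
    show "N \<subseteq> f ` N"
    proof
      fix y assume y: "y \<in> N"
      then have "y \<in> orbit f y" "orbit f y = N" using assms by (auto simp: cyclic_on_alldef)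
      then show "y \<in> f ` N" by (metis imageI orbit.cases y)
    qed
  qed
  then show ?thesis using finite_cyclic_on[OF assms] by (simp add: eq_card_imp_inj_on)
qed

definition ccw_of :: "('a \<Rightarrow> 'a) \<Rightarrow> 'a \<Rightarrow> 'a \<Rightarrow> 'a \<Rightarrow> bool" where
  "ccw_of f a b c \<longleftrightarrow> 0 < funpow_dist f a b \<and> funpow_dist f a b < funpow_dist f a c"

text \<open>\<open>C\<close> plays the part of the arc from \<open>c\<close> back to
  \<open>a\<close>: a walk from \<open>a\<close> that has reached \<open>C\<close> can leave it only
  through \<open>a\<close>. As \<open>b\<close> lies outside, it must have been met before
  \<open>c\<close>.\<close>

lemma ccw_ofI:
  assumes f: "cyclic_on f N" and N: "a \<in> N" "b \<in> N" "C \<subseteq> N" and c: "c \<in> C"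
    and ab: "a \<noteq> b" and aC: "b \<notin> C" "a \<notin> C"
    and closed: "\<And>y. y \<in> C \<Longrightarrow> f y \<in> insert a C"
  shows "ccw_of f a b c"
proof -
  have orb: "y \<in> orbit f x" if "x \<in> N" "y \<in> N" for x y
    using orbit_cyclic_eq3[OF f] that by auto
  let ?n = "funpow_dist f a b" and ?m = "funpow_dist f a c"
  have fb: "(f ^^ ?n) a = b" and fc: "(f ^^ ?m) a = c"
    using N c by (auto intro!: funpow_dist_prop orb)
  have "?n < ?m"
  proof (rule ccontr)
    assume "\<not> ?n < ?m"
    moreover have "(f ^^ k) a \<in> C" if "k \<ge> ?m" "k \<le> ?n" for k
      using that
    proof (induction k rule: dec_induct)
      case base
      then show ?case using fc c by simp
    next
      case (step k)
      then have "(f ^^ Suc k) a \<in> insert a C" using closed by simp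
      \<comment> \<open>A return to \<open>a\<close> before step \<open>?n\<close> would bring
        \<open>b\<close> closer than its least distance \<open>?n\<close>.\<close>
      moreover have "(f ^^ Suc k) a \<noteq> a"
      proof
        assume "(f ^^ Suc k) a = a"
        then have "(f ^^ (?n - Suc k)) a = (f ^^ (?n - Suc k + Suc k)) a" by (simp only: funpow_add o_apply)
        also have "\<dots> = b" using step.prems fb by simp
        finally have "(f ^^ (?n - Suc k)) a = b" .
        moreover have "?n - Suc k < ?n" using step.prems by simp
        ultimately show False using funpow_dist_least by metis
      qed
      ultimately show ?case by blast
    qed
    ultimately show False using fb aC(1) by (metis le_refl not_less)
  qed
  moreover have "0 < ?n" using funpow_dist_0_eq[OF orb[OF N(1,2)]] ab by simp
  ultimately show ?thesis by (simp add: ccw_of_def)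
qed

text \<open>The circle has been cut open at a base point; the three disjuncts differ in where the
  cut falls.\<close>

definition cyclic_ordered :: "nat \<Rightarrow> nat \<Rightarrow> nat \<Rightarrow> bool" where
  "cyclic_ordered a b c \<longleftrightarrow> a < b \<and> b < c \<or> b < c \<and> c < a \<or> c < a \<and> a < b"

lemma funpow_dist_period:
  assumes f: "cyclic_on f N" and N: "x \<in> N" "y \<in> N"
  shows "funpow_dist f x y < card N" "(f ^^ funpow_dist f x y) x = y"
    "inj_on (\<lambda>n. (f ^^ n) x) {0..<card N}" "(f ^^ card N) x = x"
proof -
  have orb: "orbit f x = N" using orbit_cyclic_eq3[OF f N(1)] .
  have x: "x \<in> orbit f x" and y: "y \<in> orbit f x" using N orb by auto
  let ?p = "funpow_dist1 f x x"
  show "(f ^^ funpow_dist f x y) x = y" by (rule funpow_dist_prop[OF y])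
  have im: "orbit f x = (\<lambda>n. (f ^^ n) x) ` {0..<?p}"
    by (rule orbit_conv_funpow_dist1[OF x])
  have inj: "inj_on (\<lambda>n. (f ^^ n) x) {0..<?p}" by (rule inj_on_funpow_dist1[OF x])
  have p: "card N = ?p" using im orb card_image[OF inj] by simp
  show "inj_on (\<lambda>n. (f ^^ n) x) {0..<card N}" "(f ^^ card N) x = x"
    unfolding p using inj funpow_dist1_prop[OF x] by auto
  obtain k where k: "k < card N" "(f ^^ k) x = y" using y im p by auto
  have "\<not> k < funpow_dist f x y" using k(2) funpow_dist_least by metis
  then show "funpow_dist f x y < card N" using k(1) by simp
qed

lemma funpow_dist_shift:
  assumes f: "cyclic_on f N" and N: "a \<in> N" "b \<in> N" "c \<in> N"
  shows "funpow_dist f b c = (if funpow_dist f a b \<le> funpow_dist f a c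
    then funpow_dist f a c - funpow_dist f a b
    else card N + funpow_dist f a c - funpow_dist f a b)"
proof -
  have pos: "funpow_dist f x y < card N" "(f ^^ funpow_dist f x y) x = y"
    "inj_on (\<lambda>n. (f ^^ n) x) {0..<card N}" "(f ^^ card N) x = x" if "x \<in> N" "y \<in> N" for x y
    using funpow_dist_period[OF f that] by auto
  let ?b = "funpow_dist f a b" and ?c = "funpow_dist f a c"
  let ?t = "if ?b \<le> ?c then ?c - ?b else card N + ?c - ?b"
  have b: "(f ^^ ?b) a = b" and c: "(f ^^ ?c) a = c" using pos N by auto
  have "(f ^^ ?t) b = (f ^^ (?t + ?b)) a" using b by (simp add: funpow_add)
  also have "\<dots> = c"
  proof (cases "?b \<le> ?c")
    case True
    then show ?thesis using c by simp
  next
    case False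
    then have "?t + ?b = ?c + card N" using pos(1)[OF N(1,2)] by simp
    then show ?thesis using pos(4)[OF N(1,1)] c by (simp add: funpow_add)
  qed
  finally have "(f ^^ ?t) b = (f ^^ funpow_dist f b c) b" using pos(2)[OF N(2,3)] by simp
  moreover have "?t < card N" using pos(1)[OF N(1,2)] pos(1)[OF N(1,3)] by auto
  ultimately have "?t = funpow_dist f b c"
    using pos(3)[OF N(2,3)] pos(1)[OF N(2,3)] by (auto dest!: inj_onD)
  then show ?thesis by simp
qed

text \<open>\<open>ccw_of\<close> counts from its own first argument. Here the count may start
  anywhere on the cycle, so the base point can be adapted to the question.\<close>

lemma ccw_of_iff:
  assumes f: "cyclic_on f N" and N: "a \<in> N" "b \<in> N" "c \<in> N" "d \<in> N"
  shows "ccw_of f b c d \<longleftrightarrow>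
    cyclic_ordered (funpow_dist f a b) (funpow_dist f a c) (funpow_dist f a d)"
proof -
  have "funpow_dist f a b < card N" "funpow_dist f a c < card N" "funpow_dist f a d < card N"
    using funpow_dist_period(1)[OF f] N by blast+
  then show ?thesis
    using funpow_dist_shift[OF f N(1,2,3)] funpow_dist_shift[OF f N(1,2,4)]
    unfolding ccw_of_def cyclic_ordered_def by (auto split: if_splits)
qed

lemma funpow_dist_Suc:
  assumes f: "cyclic_on f N" and N: "a \<in> N" "b \<in> N"
  shows "f b = a \<or> funpow_dist f a (f b) = Suc (funpow_dist f a b)"
proof -
  have "funpow_dist f a (f b) = Suc (funpow_dist f a b)" if neq: "f b \<noteq> a"
  proof -
  let ?b = "funpow_dist f a b"
  note p = funpow_dist_period[OF f N] and q = funpow_dist_period[OF f N(1) cyclic_on_inI[OF f N(2)]]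
  have fb: "(f ^^ Suc ?b) a = f b" using p(2) by simp
  then have "Suc ?b \<noteq> card N" using p(4) neq by metis
  then have "Suc ?b < card N" using p(1) by simp
  then show "funpow_dist f a (f b) = Suc ?b"
    using q(1,2) fb by (intro inj_onD[OF p(3)]) simp_all
  qed
  then show ?thesis by blast
qed

text \<open>Positions are measured from the element whose successor is sought. It has position 0 and
  its successor position 1; nothing fits strictly between, and the cyclic orders leave only two
  kinds of successor.\<close>

lemma successor_rules_if_ccw:
  fixes out :: "3 \<Rightarrow> 'a" and inc :: "3 \<Rightarrow> 'a set"
  assumes f: "cyclic_on f N" and N: "N = range out \<union> (\<Union>i. inc i)"
    and outs: "ccw_of f (out 0) (out 1) (out 2)"
    and incs: "\<And>i x. x \<in> inc i \<Longrightarrow> ccw_of f (out (i + 1)) x (out (i - 1))"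
  shows "f (out l) \<in> insert (out (l + 1)) (inc (l - 1))"
    and "x \<in> inc l \<Longrightarrow> f x \<in> insert (out (l - 1)) (inc l)"
proof -
  let ?d = "funpow_dist f"
  have outN: "out i \<in> N" for i using N by blast
  have incN: "x \<in> inc i \<Longrightarrow> x \<in> N" for i x using N by blast
  note iff = ccw_of_iff[OF f]
  have co: "cyclic_ordered (?d a (out l)) (?d a (out (l + 1))) (?d a (out (l - 1)))"
    if a: "a \<in> N" for a l
    using iff[OF a outN outN outN, of 0 1 2] outs label_exhaust[of l]
    by (auto simp: cyclic_ordered_def label_numerals)
  have ci: "cyclic_ordered (?d a (out (i + 1))) (?d a x) (?d a (out (i - 1)))"
    if a: "a \<in> N" and x: "x \<in> inc i" for a x i
    using iff[OF a outN incN[OF x] outN] incs[OF x] by simp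
  have zero: "?d a a = 0" for a by (simp add: funpow_dist_0)
  have nofix: "f a \<noteq> a" if a: "a \<in> N" for a
  proof
    assume "f a = a"
    then have "N = {a}" using orbit_eq_singleton_iff[of f a] orbit_cyclic_eq3[OF f a] by simp
    then have "out 0 = a" "out 1 = a" using outN by blast+
    then show False using co[OF a, of 0] by (auto simp: cyclic_ordered_def)
  qed
  have one: "?d a (f a) = 1" if a: "a \<in> N" for a
    using funpow_dist_Suc[OF f a a] nofix[OF a] zero by auto
  have sp: "(\<exists>k. f a = out k) \<or> (\<exists>k. f a \<in> inc k)" if "a \<in> N" for a
    using cyclic_on_inI[OF f that] N by blast
  show "f (out l) \<in> insert (out (l + 1)) (inc (l - 1))"
  proof -
    let ?a = "out l" let ?y = "f ?a"
    note a = outN[of l]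
    note pos = zero[of ?a] one[OF a] co[OF a, of l]
    from sp[OF a] show ?thesis
    proof (elim disjE exE)
      fix k assume k: "?y = out k"
      show ?thesis
        using label_cases[of k l] pos k nofix[OF a] by (auto simp: cyclic_ordered_def)
    next
      fix k assume k: "?y \<in> inc k"
      show ?thesis
        using label_cases[of k l] pos k ci[OF a k] by (auto simp: cyclic_ordered_def)
    qed
  qed
  show "f x \<in> insert (out (l - 1)) (inc l)" if x: "x \<in> inc l"
  proof -
    note a = incN[OF x]
    note pos = zero[of x] one[OF a] co[OF a, of l] ci[OF a x]
    from sp[OF a] show ?thesis
    proof (elim disjE exE)
      fix k assume k: "f x = out k"
      show ?thesis
        using label_cases[of k l] pos k by (auto simp: cyclic_ordered_def)
    next
      fix k assume k: "f x \<in> inc k"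
      show ?thesis
        using label_cases[of k l] pos k ci[OF a k] by (auto simp: cyclic_ordered_def)
    qed
  qed
qed

text \<open>Conversely, the rules let a walk leave an arc of consecutive kinds only at its end,
  which is the situation of \<open>ccw_ofI\<close>.\<close>

lemma ccw_if_successor_rules:
  fixes out :: "3 \<Rightarrow> 'a" and inc :: "3 \<Rightarrow> 'a set"
  assumes f: "cyclic_on f N" and N: "range out \<subseteq> N" "\<And>i. inc i \<subseteq> N"
    and inj: "inj out" and disj: "\<And>i k. out i \<notin> inc k" "\<And>i k. i \<noteq> k \<Longrightarrow> inc i \<inter> inc k = {}"
    and s1: "\<And>l. f (out l) \<in> insert (out (l + 1)) (inc (l - 1))"
    and s2: "\<And>l x. x \<in> inc l \<Longrightarrow> f x \<in> insert (out (l - 1)) (inc l)"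
  shows "ccw_of f (out 0) (out 1) (out 2)"
    and "x \<in> inc i \<Longrightarrow> ccw_of f (out (i + 1)) x (out (i - 1))"
proof -
  have ne: "out i = out k \<longleftrightarrow> i = k" for i k using inj by (auto dest: injD)
  show "ccw_of f (out 0) (out 1) (out 2)"
  proof (rule ccw_ofI[OF f])
    fix y assume "y \<in> insert (out 2) (inc 1)"
    then show "f y \<in> insert (out 0) (insert (out 2) (inc 1))"
      using s1[of 2] s2[of y 1] by (auto simp: label_numerals)
  qed (use N ne disj in auto)
  show "ccw_of f (out (i + 1)) x (out (i - 1))" if x: "x \<in> inc i"
  proof (rule ccw_ofI[OF f])
    \<comment> \<open>The arc from \<open>out (i - 1)\<close> round to \<open>out (i + 1)\<close>,
      the latter excluded.\<close>
    let ?C = "{out (i - 1), out i} \<union> inc (i + 1) \<union> inc (i - 1)"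
    fix y assume "y \<in> ?C"
    then show "f y \<in> insert (out (i + 1)) ?C"
      using s1[of "i - 1"] s1[of i] s2[of y "i - 1"] s2[of y "i + 1"] by auto
  next
    show "x \<notin> {out (i - 1), out i} \<union> inc (i + 1) \<union> inc (i - 1)"
      using disj(1) disj(2)[of i "i + 1"] disj(2)[of i "i - 1"] x by auto
  qed (use N ne disj x in \<open>auto simp: disjoint_iff\<close>)
qed

section \<open>Triangulations and realizers\<close>

definition triangle_faces :: "('v, 'm) plane_map_scheme \<Rightarrow> bool" where
  "triangle_faces G \<longleftrightarrow> (\<forall>a b. (a, b) \<in> darts G \<longrightarrow> rot G (rot G b a) b = a)"

text \<open>If the walk did not close up after three steps, its first four darts would be distinct:
  there are no loops, a return after two steps makes the face too small, and
  \<open>face_next\<close> is injective.\<close>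

lemma card_face_triangle:
  assumes G: "rotation_system G" and d: "(a, b) \<in> darts G"
  shows "card (orbit (face_next G) (a, b)) = 3 \<longleftrightarrow> rot G (rot G b a) b = a \<and> rot G a (rot G b a) = b"
    and "rot G (rot G b a) b = a \<Longrightarrow> rot G a (rot G b a) = b \<Longrightarrow>
      orbit (face_next G) (a, b) = {(a, b), (b, rot G b a), (rot G b a, a)}"
proof -
  let ?f = "face_next G"
  define c where "c = rot G b a"
  define e where "e = rot G c b"
  have f: "?f (a, b) = (b, c)" "?f (b, c) = (c, e)" "?f (c, e) = (e, rot G e c)"
    by (auto simp: face_next_def c_def e_def)
  have dd: "x \<in> darts G \<Longrightarrow> ?f x \<in> darts G" for x
    using face_next_bij[OF G] by (auto simp: bij_betw_def)
  have irr: "irrefl (darts G)" using G by (simp add: rotation_system_def)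
  have D: "(b, c) \<in> darts G" "(c, e) \<in> darts G" "(e, rot G e c) \<in> darts G"
    using dd d f by metis+
  then have ne: "a \<noteq> b" "b \<noteq> c" "c \<noteq> e" using d irr by (auto simp: irrefl_def)
  have inj: "inj_on ?f (darts G)" using face_next_bij[OF G] by (simp add: bij_betw_def)
  have orb: "(a, b) \<in> orbit ?f (a, b)" by (rule face_orbit(2)[OF G d])
  have o3: "(b, c) \<in> orbit ?f (a, b)" "(c, e) \<in> orbit ?f (a, b)" "(e, rot G e c) \<in> orbit ?f (a, b)"
    using f by (metis orbit.intros)+
  have fin: "finite (orbit ?f (a, b))" using orb finite_orbit by metis
  have closed: "orbit ?f (a, b) = {(a, b), (b, c), (c, a)}" if "e = a" "rot G a c = b"
  proof
    show "orbit ?f (a, b) \<subseteq> {(a, b), (b, c), (c, a)}"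
    proof
      fix x assume "x \<in> orbit ?f (a, b)"
      then show "x \<in> {(a, b), (b, c), (c, a)}"
        by induction (use f that in auto)
    qed
  qed (use orb o3 that in auto)
  then show "rot G (rot G b a) b = a \<Longrightarrow> rot G a (rot G b a) = b \<Longrightarrow>
      orbit (face_next G) (a, b) = {(a, b), (b, rot G b a), (rot G b a, a)}"
    by (simp add: c_def e_def)
  have "e = a \<and> rot G a c = b" if card3: "card (orbit ?f (a, b)) = 3"
  proof (rule ccontr)
    assume not: "\<not> (e = a \<and> rot G a c = b)"
    have "(c, e) \<noteq> (a, b)"
    proof
      assume eq: "(c, e) = (a, b)"
      have "orbit ?f (a, b) \<subseteq> {(a, b), (b, c)}"
      proof
        fix x assume "x \<in> orbit ?f (a, b)"
        then show "x \<in> {(a, b), (b, c)}" by induction (use f eq in auto)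
      qed
      then have "card (orbit ?f (a, b)) \<le> card {(a, b), (b, c)}" by (intro card_mono) auto
      also have "\<dots> \<le> 2" by (simp add: card_insert_if)
      finally show False using card3 by simp
    qed
    moreover have "(e, rot G e c) \<noteq> (a, b)" using not by auto
    moreover have "(e, rot G e c) \<noteq> (b, c)"
    proof
      assume "(e, rot G e c) = (b, c)"
      then have "?f (c, e) = ?f (a, b)" using f(1,3) by (simp only:)
      then show False using inj_onD[OF inj _ D(2) d] \<open>(c, e) \<noteq> (a, b)\<close> by blast
    qed
    moreover have "(e, rot G e c) \<noteq> (c, e)" "(b, c) \<noteq> (a, b)" "(c, e) \<noteq> (b, c)" using ne by auto
    ultimately have "distinct [(a, b), (b, c), (c, e), (e, rot G e c)]"
      unfolding distinct.simps list.set insert_iff empty_iff by metis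
    then have "card (set [(a, b), (b, c), (c, e), (e, rot G e c)]) = 4"
      by (subst distinct_card) simp_all
    moreover have "card (set [(a, b), (b, c), (c, e), (e, rot G e c)]) \<le> card (orbit ?f (a, b))"
      using orb o3 by (intro card_mono fin) auto
    ultimately show False using card3 by linarith
  qed
  moreover have "card (orbit ?f (a, b)) = 3" if "e = a \<and> rot G a c = b"
    using closed that ne by (auto simp: card_insert_if)
  ultimately show "card (orbit ?f (a, b)) = 3 \<longleftrightarrow> rot G (rot G b a) b = a \<and> rot G a (rot G b a) = b"
    unfolding c_def e_def by blast
qed

lemma triangle_facesD:
  assumes "rotation_system G" "triangle_faces G" "(b, a) \<in> darts G"
  shows "rot G (rot G b a) b = a" "rot G a (rot G b a) = b"
    "(b, rot G b a) \<in> darts G" "(a, rot G b a) \<in> darts G" "(rot G b a, a) \<in> darts G" "(rot G b a, b) \<in> darts G"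
proof -
  have sym: "sym (darts G)" using assms(1) by (simp add: rotation_system_def)
  then have ab: "(a, b) \<in> darts G" using assms(3) by (blast dest: symD)
  then show 1: "rot G (rot G b a) b = a" using assms(2) by (simp add: triangle_faces_def)
  show bc: "(b, rot G b a) \<in> darts G" using rot_bij(1)[OF assms(1,3)] .
  \<comment> \<open>The condition at the next dart of the face,
    \<open>(b, rot G b a)\<close>.\<close>
  then show "rot G a (rot G b a) = b" using assms(2) 1 unfolding triangle_faces_def by metis
  show cb: "(rot G b a, b) \<in> darts G" using bc sym by (blast dest: symD)
  then show "(rot G b a, a) \<in> darts G" using rot_bij(1)[OF assms(1) cb] 1 by simp
  then show "(a, rot G b a) \<in> darts G" using sym by (blast dest: symD)
qed

text \<open>Euler's formula for a map all of whose faces are triangles reduces to a count of darts.\<close>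

lemma triangulation_iff:
  "triangulation T \<longleftrightarrow> rotation_system T \<and> connected_map T \<and> card (verts T) \<ge> 3 \<and>
     triangle_faces T \<and> card (darts T) + 12 = 6 * card (verts T) \<and>
     (\<exists>a b. (a, b) \<in> darts T \<and> {a, b, rot T b a} = range (root T))"
proof (cases "rotation_system T")
  case rs: True
  have sym: "sym (darts T)" using rs by (simp add: rotation_system_def)
  have tf: "(\<forall>F\<in>faces T. card F = 3) \<longleftrightarrow> triangle_faces T"
  proof
    assume "\<forall>F\<in>faces T. card F = 3"
    then show "triangle_faces T"
      using card_face_triangle(1)[OF rs] unfolding triangle_faces_def faces_def by blast
  next
    assume t: "triangle_faces T"
    show "\<forall>F\<in>faces T. card F = 3"
    proof
      fix F assume "F \<in> faces T"
      then obtain a b where ab: "(a, b) \<in> darts T" "F = orbit (face_next T) (a, b)"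
        unfolding faces_def by auto
      then have "(b, a) \<in> darts T" using sym by (blast dest: symD)
      then show "card F = 3"
        using triangle_facesD(1,2)[OF rs t] card_face_triangle(1)[OF rs ab(1)] ab(2) by blast
    qed
  qed
  have cf: "card (verts T) + card (faces T) = card (edges T) + 2 \<longleftrightarrow>
      card (darts T) + 12 = 6 * card (verts T)" if "triangle_faces T"
  proof -
    have "3 * card (faces T) = card (darts T)"
      using sum_card_faces[OF rs] that tf by simp
    then show ?thesis using card_darts[OF rs] by linarith
  qed
  have outer: "(\<exists>F\<in>faces T. fst ` F = range (root T)) \<longleftrightarrow>
      (\<exists>a b. (a, b) \<in> darts T \<and> {a, b, rot T b a} = range (root T))" if t: "triangle_faces T"
  proof -
    have "fst ` orbit (face_next T) (a, b) = {a, b, rot T b a}" if ab: "(a, b) \<in> darts T" for a b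
    proof -
      have "(b, a) \<in> darts T" using ab sym by (blast dest: symD)
      then show ?thesis
        using card_face_triangle(2)[OF rs ab] triangle_facesD(1,2)[OF rs t] by (simp add: insert_commute)
    qed
    then show ?thesis unfolding faces_def by (simp add: Bex_def split_paired_Ex cong: conj_cong)
  qed
  show ?thesis
    unfolding triangulation_def plane_graph_def using rs tf cf outer by blast
qed (simp add: triangulation_def plane_graph_def)

lemma triangulation_roots:
  assumes "triangulation T"
  shows "inj (root T)" "i \<noteq> k \<Longrightarrow> (root T i, root T k) \<in> darts T"
proof -
  have rs: "rotation_system T" and t: "triangle_faces T"
    using assms unfolding triangulation_iff by auto
  have sym: "sym (darts T)" and irr: "irrefl (darts T)"
    using rs by (auto simp: rotation_system_def)
  obtain a b where ab: "(a, b) \<in> darts T" "{a, b, rot T b a} = range (root T)"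
    using assms unfolding triangulation_iff by auto
  have ba: "(b, a) \<in> darts T" using ab sym by (blast dest: symD)
  note d = triangle_facesD(3-6)[OF rs t ba]
  have ne: "a \<noteq> b" "b \<noteq> rot T b a" "a \<noteq> rot T b a" using ab(1) d irr by (auto simp: irrefl_def)
  then have "card (range (root T)) = 3" using ab(2)[symmetric] by simp
  then show inj: "inj (root T)" by (intro eq_card_imp_inj_on) auto
  have "(x, y) \<in> darts T" if "x \<in> range (root T)" "y \<in> range (root T)" "x \<noteq> y" for x y
    using that d ab(1) ba unfolding ab(2)[symmetric] by auto
  then show "i \<noteq> k \<Longrightarrow> (root T i, root T k) \<in> darts T" using inj by (auto dest: injD)
qed

lemma triangulationD:
  assumes "triangulation T"
  shows "rotation_system T" "triangle_faces T"
  using assms unfolding triangulation_iff by auto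

text \<open>
  The cyclic order of the edges at an inner vertex, \<open>out 0\<close>, \<open>in 2\<close>, \<open>out 1\<close>, \<open>in 0\<close>, \<open>out 2\<close>,
  \<open>in 1\<close>, is expressed by the kinds of edges that may follow each other (\<open>succ_out\<close>, \<open>succ_in\<close>).
\<close>

locale schnyder_wood =
  fixes T :: "'v outer_map" and R :: "3 \<Rightarrow> ('v \<times> 'v) set"
  assumes rotation: "rotation_system T"
    and triangles: "triangle_faces T"
    and labelled_dart: "(x, y) \<in> R i \<Longrightarrow> (x, y) \<in> darts T"
    and labelled_inner: "(x, y) \<in> R i \<Longrightarrow> x \<in> inner_verts T"
    and label_exists: "(x, y) \<in> darts T \<Longrightarrow> x \<in> inner_verts T \<Longrightarrow> \<exists>i. (x, y) \<in> R i \<or> (y, x) \<in> R i"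
    and label_unique: "(x, y) \<in> R i \<Longrightarrow> (x, y) \<in> R k \<Longrightarrow> i = k"
    and label_asym: "(x, y) \<in> R i \<Longrightarrow> (y, x) \<notin> R k"
    and out_exists: "u \<in> inner_verts T \<Longrightarrow> \<exists>v. (u, v) \<in> R i"
    and out_unique: "(u, v) \<in> R i \<Longrightarrow> (u, v') \<in> R i \<Longrightarrow> v = v'"
    and succ_out: "(u, v) \<in> R i \<Longrightarrow> (rot T u v, u) \<in> R (i - 1) \<or> (u, rot T u v) \<in> R (i + 1)"
    and succ_in: "(x, u) \<in> R i \<Longrightarrow> u \<in> inner_verts T \<Longrightarrow>
      (rot T u x, u) \<in> R i \<or> (u, rot T u x) \<in> R (i - 1)"
    and root_target: "(x, y) \<in> R i \<Longrightarrow> y \<notin> inner_verts T \<Longrightarrow> y = root T i"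
    and label_acyclic: "acyclic (R i)"
    and inj_root: "inj (root T)"

section \<open>Realizers and local rules are equivalent\<close>

lemma ccw_eq: "ccw G u a b c = ccw_of (rot G u) a b c"
  by (simp add: ccw_def ccw_of_def)

lemma ex1_eqE: "\<exists>!t. Q t \<Longrightarrow> Q a \<Longrightarrow> Q b \<Longrightarrow> a = b"
  by blast

lemma directed_partitionD:
  assumes "directed_partition E R"
  shows "(x, y) \<in> R i \<Longrightarrow> {x, y} \<in> E"
    and "{x, y} \<in> E \<Longrightarrow> \<exists>i. (x, y) \<in> R i \<or> (y, x) \<in> R i"
    and "(x, y) \<in> R i \<Longrightarrow> (x', y') \<in> R k \<Longrightarrow> {x, y} = {x', y'} \<Longrightarrow> i = k \<and> x = x' \<and> y = y'"
proof -
  show 1: "(x, y) \<in> R i \<Longrightarrow> {x, y} \<in> E" for x y i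
    using assms by (simp add: directed_partition_def)
  have ex: "\<exists>!(i, a, b). (a, b) \<in> R i \<and> {a, b} = e" if "e \<in> E" for e
    using assms that by (simp add: directed_partition_def)
  show "\<exists>i. (x, y) \<in> R i \<or> (y, x) \<in> R i" if "{x, y} \<in> E"
    using ex[OF that] by (auto simp: doubleton_eq_iff dest!: ex1_implies_ex)
  show "i = k \<and> x = x' \<and> y = y'" if "(x, y) \<in> R i" "(x', y') \<in> R k" "{x, y} = {x', y'}"
  proof -
    let ?Q = "\<lambda>(i, a, b). (a, b) \<in> R i \<and> {a, b} = {x, y}"
    have "\<exists>!t. ?Q t" using ex[OF 1[OF that(1)]] .
    moreover have "?Q (i, x, y)" "?Q (k, x', y')" using that by simp_all
    ultimately have "(i, x, y) = (k, x', y')" by (rule ex1_eqE)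
    then show ?thesis by simp
  qed
qed

text \<open>A cycle through \<open>y\<close> runs through the only successor of \<open>y\<close>,
  hence follows the path to \<open>r\<close>, where no edge starts.\<close>

lemma tree_towards_acyclic:
  assumes "tree_towards E r"
  shows "acyclic E"
proof -
  have E: "single_valued E" "r \<notin> Domain E" "\<And>v. v \<in> Field E \<Longrightarrow> (v, r) \<in> E\<^sup>*"
    using assms by (auto simp: tree_towards_def)
  have "(v, v) \<notin> E\<^sup>+" if "(v, r) \<in> E\<^sup>*" for v
    using that
  proof (induction rule: converse_rtrancl_induct)
    case base
    then show ?case using E(2) by (auto dest: tranclD)
  next
    case (step y z)
    show ?case
    proof
      assume "(y, y) \<in> E\<^sup>+"
      then obtain z' where "(y, z') \<in> E" "(z', y) \<in> E\<^sup>*" by (auto dest: tranclD)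
      then have "(z, y) \<in> E\<^sup>*" using step(1) E(1) by (auto simp: single_valued_def)
      then have "(z, z) \<in> E\<^sup>+" using step(1) by (rule rtrancl_into_trancl1)
      then show False using step(3) by blast
    qed
  qed
  moreover have "v \<in> Field E" if "(v, v) \<in> E\<^sup>+" for v
    using that by (auto dest!: tranclD simp: Field_def)
  ultimately show ?thesis using E(3) unfolding acyclic_def by blast
qed

lemma inner_edges_iff:
  assumes "rotation_system T"
  shows "{x, y} \<in> inner_edges T \<longleftrightarrow> (x, y) \<in> darts T \<and> (x \<in> inner_verts T \<or> y \<in> inner_verts T)"
proof -
  have "(x, y) \<in> darts T \<longleftrightarrow> (y, x) \<in> darts T" and "(x, y) \<in> darts T \<Longrightarrow> x \<in> verts T \<and> y \<in> verts T"
    using assms unfolding rotation_system_def by (auto dest: symD)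
  then show ?thesis
    unfolding inner_edges_def edges_def inner_verts_def by (auto simp: doubleton_eq_iff)
qed

lemma cyclic_on_rot:
  assumes "rotation_system G" "(v, w) \<in> darts G"
  shows "cyclic_on (rot G v) (neighbours G v)"
  using assms unfolding rotation_system_def neighbours_def by blast

text \<open>With the converse \<open>schnyder_wood.realizer\<close>, this replaces
  \<open>ccw\<close> by the successor rules and the tree condition by acyclicity and
  \<open>root_target\<close>.\<close>

lemma realizer_schnyder_wood:
  fixes T :: "'v outer_map"
  assumes T: "triangulation T" and R: "realizer T R"
  shows "schnyder_wood T R"
proof -
  note rs = triangulationD(1)[OF T] and tf = triangulationD(2)[OF T]
  define P where "P u out \<longleftrightarrow> (\<forall>i v. (u, v) \<in> R i \<longleftrightarrow> v = out i) \<and>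
        ccw T u (out 0) (out 1) (out 2) \<and>
        (\<forall>i x. (x, u) \<in> R i \<longrightarrow> ccw T u (out (i + 1)) x (out (i - 1)))" for u and out
  have dp: "directed_partition (inner_edges T) R"
    and loc: "\<And>u. u \<in> inner_verts T \<Longrightarrow> \<exists>out. P u out"
    and dom: "\<And>k i. root T k \<notin> Domain (R i)"
    and tree: "\<And>i. tree_towards (R i) (root T i)"
    using R unfolding realizer_def P_def by auto
  note dpD = directed_partitionD[OF dp]
  have sub: "darts T \<subseteq> verts T \<times> verts T" and sym: "sym (darts T)" and irr: "irrefl (darts T)"
    using rs by (auto simp: rotation_system_def)
  have dart: "(x, y) \<in> darts T" if "(x, y) \<in> R i" for x y i
    using dpD(1)[OF that] by (simp add: inner_edges_iff[OF rs])
  have inn: "x \<in> inner_verts T" if "(x, y) \<in> R i" for x y i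
    using dart[OF that] sub dom that unfolding inner_verts_def by blast
  have ex: "\<exists>i. (x, y) \<in> R i \<or> (y, x) \<in> R i" if "(x, y) \<in> darts T" "x \<in> inner_verts T" for x y
    using dpD(2)[of x y] that by (simp add: inner_edges_iff[OF rs])
  have local: "f (out l) \<in> insert (out (l + 1)) {x. (x, u) \<in> R (l - 1)}"
      "(x, u) \<in> R l \<Longrightarrow> f x \<in> insert (out (l - 1)) {x. (x, u) \<in> R l}"
    if u: "u \<in> inner_verts T" and o: "P u out" and f: "f = rot T u"
    for u out f l x
  proof -
    have out: "\<And>i v. (u, v) \<in> R i \<longleftrightarrow> v = out i" "ccw T u (out 0) (out 1) (out 2)"
      "\<And>i x. (x, u) \<in> R i \<Longrightarrow> ccw T u (out (i + 1)) x (out (i - 1))"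
      using o unfolding P_def by simp_all
    have "(u, out 0) \<in> R 0" using out(1) by simp
    then have cyc: "cyclic_on f (neighbours T u)" using cyclic_on_rot[OF rs dart] f by simp
    have N: "neighbours T u = range out \<union> (\<Union>i. {x. (x, u) \<in> R i})"
    proof (intro set_eqI iffI)
      fix y assume "y \<in> neighbours T u"
      then obtain k where "(u, y) \<in> R k \<or> (y, u) \<in> R k"
        using ex[OF _ u] by (auto simp: neighbours_def)
      then show "y \<in> range out \<union> (\<Union>i. {x. (x, u) \<in> R i})"
        using out(1) by blast
    next
      fix y assume "y \<in> range out \<union> (\<Union>i. {x. (x, u) \<in> R i})"
      then obtain i where "(u, y) \<in> R i \<or> (y, u) \<in> R i" using out(1) by blast
      then show "y \<in> neighbours T u"
        using dart sym by (auto simp: neighbours_def dest: symD)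
    qed
    show "f (out l) \<in> insert (out (l + 1)) {x. (x, u) \<in> R (l - 1)}"
      "(x, u) \<in> R l \<Longrightarrow> f x \<in> insert (out (l - 1)) {x. (x, u) \<in> R l}"
      using successor_rules_if_ccw[OF cyc N] out(2,3) f by (simp_all add: ccw_eq)
  qed
  have outP: "(u, v) \<in> R i \<longleftrightarrow> v = out i" if "P u out" for u out v i
    using that unfolding P_def by simp
  show ?thesis
  proof
    show "\<exists>v. (u, v) \<in> R i" if "u \<in> inner_verts T" for u i using loc[OF that] outP by blast
    show "v = v'" if "(u, v) \<in> R i" "(u, v') \<in> R i" for u v v' i
      using loc[OF inn[OF that(1)]] outP that by metis
    show "(rot T u v, u) \<in> R (i - 1) \<or> (u, rot T u v) \<in> R (i + 1)" if "(u, v) \<in> R i" for u v i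
    proof -
      note u = inn[OF that]
      obtain out where o: "P u out" using loc[OF u] by blast
      have "v = out i" using outP[OF o] that by simp
      then show ?thesis using local(1)[OF u o refl, of i] outP[OF o] by auto
    qed
    show "(rot T u x, u) \<in> R i \<or> (u, rot T u x) \<in> R (i - 1)"
      if x: "(x, u) \<in> R i" and u: "u \<in> inner_verts T" for x u i
    proof -
      obtain out where o: "P u out" using loc[OF u] by blast
      show ?thesis using local(2)[OF u o refl x] outP[OF o] by auto
    qed
    show "y = root T i" if xy: "(x, y) \<in> R i" and y: "y \<notin> inner_verts T" for x y i
    proof -
      have "y \<in> verts T" using dart[OF xy] sub by blast
      then obtain k where k: "y = root T k" using y unfolding inner_verts_def by blast
      \<comment> \<open>No edge starts at the root \<open>y\<close>, so its path to
        \<open>root T i\<close> is empty.\<close>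
      have "(y, root T i) \<in> (R i)\<^sup>*" using tree[of i] xy unfolding tree_towards_def Field_def by blast
      then show ?thesis using dom k by (metis DomainI converse_rtranclE)
    qed
    show "i = k" if "(x, y) \<in> R i" "(x, y) \<in> R k" for x y i k using dpD(3)[OF that] by blast
    show "(y, x) \<notin> R k" if "(x, y) \<in> R i" for x y i k
      using dpD(3)[OF that, of y x k] dart[OF that] irr by (auto simp: irrefl_def insert_commute)
    show "acyclic (R i)" for i by (rule tree_towards_acyclic[OF tree])
    show "inj (root T)" by (rule triangulation_roots(1)[OF T])
  qed (use rs tf dart inn ex in blast)+
qed

context schnyder_wood
begin

lemma dart_sym: "(x, y) \<in> darts T \<longleftrightarrow> (y, x) \<in> darts T"
  using rotation unfolding rotation_system_def by (auto dest: symD)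

lemma dart_irrefl [simp]: "(x, x) \<notin> darts T"
  using rotation unfolding rotation_system_def irrefl_def by blast

lemma dart_verts: "(x, y) \<in> darts T \<Longrightarrow> x \<in> verts T \<and> y \<in> verts T"
  using rotation unfolding rotation_system_def by blast

lemma labelled_dart': "(x, y) \<in> R i \<Longrightarrow> (y, x) \<in> darts T"
  using labelled_dart dart_sym by blast

lemma root_not_inner: "root T i \<notin> inner_verts T"
  by (simp add: inner_verts_def)

lemma finite_verts: "finite (verts T)"
  using rotation by (simp add: rotation_system_def)

lemma finite_label: "finite (R i)"
proof (rule finite_subset)
  show "R i \<subseteq> darts T" using labelled_dart by auto
qed (rule finite_darts[OF rotation])

lemma label_irrefl [simp]: "(x, x) \<notin> R i"
  using labelled_dart by fastforce

lemma rot_inj: "(u, x) \<in> darts T \<Longrightarrow> (u, y) \<in> darts T \<Longrightarrow> rot T u x = rot T u y \<Longrightarrow> x = y"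
  using rot_bij(2)[OF rotation] by (auto simp: neighbours_def dest: inj_onD)

lemma rot_dart: "(u, x) \<in> darts T \<Longrightarrow> (u, rot T u x) \<in> darts T"
  using rot_bij(1)[OF rotation] .

lemma rot_closed:
  assumes "A \<subseteq> neighbours T u" "a \<in> A" "\<And>x. x \<in> A \<Longrightarrow> rot T u x \<in> A"
  shows "A = neighbours T u"
proof -
  have "(u, a) \<in> darts T" using assms by (auto simp: neighbours_def)
  then show ?thesis using cyclic_on_closed[OF cyclic_on_rot[OF rotation] assms] by blast
qed

lemma rot_surj: "(u, y) \<in> darts T \<Longrightarrow> \<exists>x. (u, x) \<in> darts T \<and> rot T u x = y"
proof -
  assume y: "(u, y) \<in> darts T"
  have "rot T u ` neighbours T u = neighbours T u"
    using rot_closed[of "rot T u ` neighbours T u" u "rot T u y"] rot_dart y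
    by (auto simp: neighbours_def)
  then have "y \<in> rot T u ` neighbours T u" using y by (simp add: neighbours_def)
  then show ?thesis by (auto simp: neighbours_def)
qed

lemmas triangle = triangle_facesD[OF rotation triangles]

text \<open>The rules read clockwise: the edge to \<open>y\<close> has some label, and its own
  successor rule admits the given successor in just two cases.\<close>

lemma pred_out:
  assumes u: "(u, rot T u y) \<in> R i" and y: "(u, y) \<in> darts T"
  shows "(y, u) \<in> R (i + 1) \<or> (u, y) \<in> R (i - 1)"
proof -
  obtain k where k: "(u, y) \<in> R k \<or> (y, u) \<in> R k" using label_exists[OF y labelled_inner[OF u]] by blast
  from k show ?thesis
  proof
    assume yk: "(u, y) \<in> R k"
    then have "(u, rot T u y) \<in> R (k + 1)" using succ_out[OF yk] label_asym[OF u] by blast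
    then have "k = i - 1" using label_unique[OF u] by auto
    then show ?thesis using yk by simp
  next
    assume yk: "(y, u) \<in> R k"
    then have "(u, rot T u y) \<in> R (k - 1)"
      using succ_in[OF yk labelled_inner[OF u]] label_asym[OF u] by blast
    then have "k = i + 1" using label_unique[OF u] by auto
    then show ?thesis using yk by simp
  qed
qed

lemma pred_in:
  assumes u: "(rot T u y, u) \<in> R i" "u \<in> inner_verts T" and y: "(u, y) \<in> darts T"
  shows "(y, u) \<in> R i \<or> (u, y) \<in> R (i + 1)"
proof -
  obtain k where k: "(u, y) \<in> R k \<or> (y, u) \<in> R k" using label_exists[OF y u(2)] by blast
  from k show ?thesis
  proof
    assume yk: "(u, y) \<in> R k"
    then have "(rot T u y, u) \<in> R (k - 1)" using succ_out[OF yk] label_asym[OF u(1)] by blast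
    then have "k = i + 1" using label_unique[OF u(1)] by auto
    then show ?thesis using yk by simp
  next
    assume yk: "(y, u) \<in> R k"
    then have "(rot T u y, u) \<in> R k" using succ_in[OF yk u(2)] label_asym[OF u(1)] by blast
    then have "k = i" using label_unique[OF u(1)] by auto
    then show ?thesis using yk by simp
  qed
qed

lemma tree: "tree_towards (R i) (root T i)"
  unfolding tree_towards_def
proof (intro conjI ballI)
  show "single_valued (R i)" using out_unique by (auto simp: single_valued_def)
  show "root T i \<notin> Domain (R i)" using labelled_inner root_not_inner by blast
  have "wf ((R i)\<inverse>)" by (rule finite_acyclic_wf_converse[OF finite_label label_acyclic])
  then have inner: "v \<in> inner_verts T \<longrightarrow> (v, root T i) \<in> (R i)\<^sup>*" for v
  proof (induction v rule: wf_induct_rule)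
    case (less v)
    show ?case
    proof
      assume "v \<in> inner_verts T"
      then obtain w where w: "(v, w) \<in> R i" using out_exists by blast
      then have "(w, root T i) \<in> (R i)\<^sup>*" using less root_target[OF w] by blast
      then show "(v, root T i) \<in> (R i)\<^sup>*" using w by (rule converse_rtrancl_into_rtrancl[rotated])
    qed
  qed
  show "(v, root T i) \<in> (R i)\<^sup>*" if "v \<in> Field (R i)" for v
    using that inner labelled_inner root_target unfolding Field_def by blast
qed

lemma realizer: "realizer T R"
  unfolding realizer_def
proof (intro conjI allI ballI)
  show "directed_partition (inner_edges T) R"
    unfolding directed_partition_def
  proof (intro conjI allI impI ballI)
    show "{x, y} \<in> inner_edges T" if "(x, y) \<in> R i" for i x y
      using that labelled_dart labelled_inner by (auto simp: inner_edges_iff[OF rotation])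
    show "\<exists>!(i, x, y). (x, y) \<in> R i \<and> {x, y} = e" if e: "e \<in> inner_edges T" for e
    proof -
      obtain a b where ab: "e = {a, b}" using e unfolding inner_edges_def edges_def by blast
      then have "(a, b) \<in> darts T" "(b, a) \<in> darts T" "a \<in> inner_verts T \<or> b \<in> inner_verts T"
        using e dart_sym by (auto simp: inner_edges_iff[OF rotation])
      then obtain i where "(a, b) \<in> R i \<or> (b, a) \<in> R i" using label_exists by blast
      then obtain x y where xy: "(x, y) \<in> R i" "{x, y} = e" using ab by (auto simp: insert_commute)
      show ?thesis
      proof (rule ex1I[of _ "(i, x, y)"])
        show "case (i, x, y) of (i, x, y) \<Rightarrow> (x, y) \<in> R i \<and> {x, y} = e" using xy by simp
        fix t assume t: "case t of (i, x, y) \<Rightarrow> (x, y) \<in> R i \<and> {x, y} = e"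
        then show "t = (i, x, y)" using xy label_unique label_asym
          by (cases t) (auto simp: doubleton_eq_iff)
      qed
    qed
  qed
  show "\<exists>out. (\<forall>i v. ((u, v) \<in> R i) = (v = out i)) \<and> ccw T u (out 0) (out 1) (out 2) \<and>
      (\<forall>i x. (x, u) \<in> R i \<longrightarrow> ccw T u (out (i + 1)) x (out (i - 1)))" if u: "u \<in> inner_verts T" for u
  proof -
    obtain out where o: "\<And>i. (u, out i) \<in> R i" using out_exists[OF u] by metis
    have out: "(u, v) \<in> R i \<longleftrightarrow> v = out i" for i v using o out_unique by blast
    note cyc = cyclic_on_rot[OF rotation labelled_dart[OF o[of 0]]]
    note rules = ccw_if_successor_rules[OF cyc, of out "\<lambda>i. {x. (x, u) \<in> R i}"]
    have "range out \<subseteq> neighbours T u" "\<And>i. {x. (x, u) \<in> R i} \<subseteq> neighbours T u"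
      using o labelled_dart labelled_dart' by (auto simp: neighbours_def)
    moreover have "inj out" using o label_unique by (metis injI)
    moreover have "out i \<notin> {x. (x, u) \<in> R k}" for i k using o label_asym by blast
    moreover have "{x. (x, u) \<in> R i} \<inter> {x. (x, u) \<in> R k} = {}" if "i \<noteq> k" for i k
      using that label_unique by blast
    moreover have "rot T u (out l) \<in> insert (out (l + 1)) {x. (x, u) \<in> R (l - 1)}" for l
      using succ_out[OF o[of l]] out by auto
    moreover have "rot T u x \<in> insert (out (l - 1)) {x. (x, u) \<in> R l}" if "x \<in> {x. (x, u) \<in> R l}" for l x
      using succ_in[OF _ u, of x l] out that by auto
    ultimately show ?thesis
      using rules out by (intro exI[of _ out]) (simp add: ccw_eq)
  qed
  show "root T k \<notin> Domain (R i)" for k i using labelled_inner root_not_inner by blast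
  show "tree_towards (R i) (root T i)" for i by (rule tree)
qed

end

section \<open>Heights\<close>

definition height_function :: "(3 \<Rightarrow> ('v \<times> 'v) set) \<Rightarrow> 3 \<Rightarrow> ('v \<Rightarrow> nat) \<Rightarrow> bool" where
  "height_function R j h \<longleftrightarrow> (\<forall>x y. ((x, y) \<in> R j \<longrightarrow> h x < h y) \<and>
     ((x, y) \<in> R (j + 1) \<or> (x, y) \<in> R (j - 1) \<longrightarrow> h y < h x))"

context schnyder_wood
begin

definition above :: "3 \<Rightarrow> ('v \<times> 'v) set" where
  "above j = R j \<union> (R (j + 1))\<inverse> \<union> (R (j - 1))\<inverse>"

text \<open>
  The well-founded part, which turns out to contain all vertices: at its boundary there would be
  an infinite descent in the tree of label \<open>j - 1\<close> or \<open>j + 1\<close>.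
\<close>

definition top_part :: "3 \<Rightarrow> 'v set" where
  "top_part j = Wellfounded.acc ((above j)\<inverse>)"

lemma top_part_up: "x \<in> top_part j \<Longrightarrow> (x, y) \<in> above j \<Longrightarrow> y \<in> top_part j"
  unfolding top_part_def by (rule acc_downward) auto

lemma top_partI: "(\<And>y. (x, y) \<in> above j \<Longrightarrow> y \<in> top_part j) \<Longrightarrow> x \<in> top_part j"
  unfolding top_part_def by (rule acc.accI) auto

text \<open>No upward edge starts here: the root has no outgoing edges, and
  \<open>root_target\<close> forbids incoming ones of another label.\<close>

lemma root_top_part: "root T j \<in> top_part j"
proof (rule top_partI)
  fix y assume "(root T j, y) \<in> above j"
  then consider "(root T j, y) \<in> R j" | "(y, root T j) \<in> R (j + 1)" | "(y, root T j) \<in> R (j - 1)"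
    by (auto simp: above_def)
  then show "y \<in> top_part j"
  proof cases
    case 1
    then show ?thesis using labelled_inner root_not_inner by blast
  next
    case 2
    then show ?thesis using root_target[OF 2 root_not_inner] injD[OF inj_root, of j "j + 1"] by simp
  next
    case 3
    then show ?thesis using root_target[OF 3 root_not_inner] injD[OF inj_root, of j "j - 1"] by simp
  qed
qed

text \<open>The top part is closed upwards, so an edge across its boundary leads up into it.\<close>

lemma top_part_neighbour:
  assumes x: "x \<in> inner_verts T" "x \<notin> top_part j" and s: "(x, s) \<in> darts T" "s \<in> top_part j"
  shows "(x, s) \<in> R j \<or> (s, x) \<in> R (j + 1) \<or> (s, x) \<in> R (j - 1)"
proof -
  have "(s, x) \<notin> above j" using top_part_up s x by blast
  moreover obtain k where "(x, s) \<in> R k \<or> (s, x) \<in> R k" using label_exists[OF s(1) x(1)] by blast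
  ultimately show ?thesis
    using label_cases[of k j] by (auto simp: above_def)
qed

text \<open>Only the case \<open>(s, x) \<in> R (j + 1)\<close> is not settled by the rule at
  \<open>x\<close>. It cannot occur: the rule at the third corner of the face would direct the
  remaining edge up from \<open>s\<close>, out of the top part.\<close>

lemma top_part_exit:
  assumes x: "x \<in> inner_verts T" "x \<notin> top_part j" and s: "(x, s) \<in> darts T" "s \<in> top_part j"
    and y: "rot T x s \<notin> top_part j"
  shows "(x, rot T x s) \<in> R (j + 1) \<or> (rot T x s, x) \<in> R (j - 1)"
proof -
  define y where "y = rot T x s"
  have yS: "(s, y) \<notin> above j" using top_part_up s(2) y by (auto simp: y_def)
  have rot: "rot T y x = s" using triangle(1)[OF s(1)] by (simp add: y_def)
  from top_part_neighbour[OF x s] consider "(x, s) \<in> R j" | "(s, x) \<in> R (j - 1)" | "(s, x) \<in> R (j + 1)"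
    by blast
  then have "(x, y) \<in> R (j + 1) \<or> (y, x) \<in> R (j - 1)"
  proof cases
    case 1
    then show ?thesis using succ_out[OF 1] by (auto simp: y_def)
  next
    case 2
    then show ?thesis using succ_in[OF 2 x(1)] by (auto simp: y_def)
  next
    case 3
    from succ_in[OF 3 x(1)] have "(y, x) \<in> R (j + 1) \<or> (x, y) \<in> R j" by (simp add: y_def)
    then show ?thesis
    proof
      assume "(y, x) \<in> R (j + 1)"
      from succ_out[OF this] rot have "(s, y) \<in> R j \<or> (y, s) \<in> R (j - 1)" by simp
      then show ?thesis using yS by (auto simp: above_def)
    next
      assume xy: "(x, y) \<in> R j"
      then have "y \<in> inner_verts T" using root_target root_top_part y by (metis y_def)
      from succ_in[OF xy this] rot have "(s, y) \<in> R j \<or> (y, s) \<in> R (j - 1)" by simp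
      then show ?thesis using yS by (auto simp: above_def)
    qed
  qed
  then show ?thesis by (simp add: y_def)
qed

text \<open>The mirror image of \<open>top_part_exit\<close>, with the labels \<open>j + 1\<close>
  and \<open>j - 1\<close> exchanged.\<close>

lemma top_part_enter:
  assumes x: "x \<in> inner_verts T" "x \<notin> top_part j" and y: "(x, y) \<in> darts T" "y \<notin> top_part j"
    and s: "rot T x y \<in> top_part j"
  shows "(x, y) \<in> R (j - 1) \<or> (y, x) \<in> R (j + 1)"
proof -
  define s where "s = rot T x y"
  have sS: "s \<in> top_part j" using s by (simp add: s_def)
  have yS: "(s, y) \<notin> above j" using top_part_up sS y(2) by blast
  have rot: "rot T y s = x" and ys: "(y, s) \<in> darts T" using triangle[OF y(1)] by (simp_all add: s_def)
  have xs: "(x, s) \<in> darts T" using rot_dart[OF y(1)] by (simp add: s_def)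
  from top_part_neighbour[OF x xs sS] consider "(x, s) \<in> R j" | "(s, x) \<in> R (j + 1)" | "(s, x) \<in> R (j - 1)"
    by blast
  then show ?thesis
  proof cases
    case 1
    then show ?thesis using pred_out[OF _ y(1), of j] by (auto simp: s_def)
  next
    case 2
    then show ?thesis using pred_in[OF _ x(1) y(1), of "j + 1"] by (auto simp: s_def)
  next
    case 3
    then have "(y, x) \<in> R (j - 1) \<or> (x, y) \<in> R j" using pred_in[OF _ x(1) y(1), of "j - 1"] by (simp add: s_def)
    then show ?thesis
    proof
      assume "(y, x) \<in> R (j - 1)"
      with pred_out[of y s "j - 1"] rot ys have "(s, y) \<in> R j \<or> (y, s) \<in> R (j + 1)" by simp
      then show ?thesis using yS by (auto simp: above_def)
    next
      assume xy: "(x, y) \<in> R j"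
      then have "y \<in> inner_verts T" using root_target root_top_part y by metis
      with pred_in[of y s j] xy rot ys have "(s, y) \<in> R j \<or> (y, s) \<in> R (j + 1)" by simp
      then show ?thesis using yS by (auto simp: above_def)
    qed
  qed
qed

text \<open>The second alternative of \<open>top_part_exit\<close>. It leads to the child
  \<open>rot T x s\<close>, so it can be refuted by descent in the tree of label
  \<open>j - 1\<close>.\<close>

definition bad_exit :: "3 \<Rightarrow> 'v \<Rightarrow> bool" where
  "bad_exit j x \<longleftrightarrow> x \<in> inner_verts T \<and> x \<notin> top_part j \<and>
     (\<exists>s. (x, s) \<in> darts T \<and> s \<in> top_part j \<and> rot T x s \<notin> top_part j \<and> (rot T x s, x) \<in> R (j - 1))"

text \<open>
  Otherwise all neighbours in the sector between the outgoing edges of labels \<open>j - 1\<close> and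
  \<open>j + 1\<close> would lie in \<open>top_part j\<close>, and so would the vertex itself.
\<close>

lemma bad_exitI:
  assumes y: "y \<in> inner_verts T" "y \<notin> top_part j" and x: "(y, x) \<in> R (j - 1)" "rot T y x \<in> top_part j"
  shows "bad_exit j y"
proof (rule ccontr)
  assume nb: "\<not> bad_exit j y"
  \<comment> \<open>From \<open>x\<close> the rotation enters the top part, leaves it only along the
    outgoing edge of label \<open>j + 1\<close>, and returns to \<open>x\<close> through incoming
    edges of label \<open>j\<close>. So \<open>A\<close> is closed under it.\<close>
  define A where "A = {t. (y, t) \<in> darts T \<and>
    (t \<in> top_part j \<or> (y, t) \<in> R (j + 1) \<or> (t, y) \<in> R j \<or> t = x)}"
  have "A = neighbours T y"
  proof (rule rot_closed)
    show "A \<subseteq> neighbours T y" by (auto simp: A_def neighbours_def)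
    show "x \<in> A" using labelled_dart[OF x(1)] by (simp add: A_def)
    fix t assume t: "t \<in> A"
    then have d: "(y, t) \<in> darts T" by (simp add: A_def)
    from t consider "t \<in> top_part j" | "(y, t) \<in> R (j + 1)" | "(t, y) \<in> R j" | "t = x"
      by (auto simp: A_def)
    then have "rot T y t \<in> top_part j \<or> (y, rot T y t) \<in> R (j + 1) \<or> (rot T y t, y) \<in> R j \<or> rot T y t = x"
    proof cases
      case 1
      then show ?thesis using top_part_exit[OF y d 1] nb y d 1 unfolding bad_exit_def by blast
    next
      case 2
      then show ?thesis using succ_out[OF 2] out_unique[OF _ x(1)] by auto
    next
      case 3
      then show ?thesis using succ_in[OF 3 y(1)] out_unique[OF _ x(1)] by auto
    next
      case 4
      then show ?thesis using x(2) by simp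
    qed
    then show "rot T y t \<in> A" using rot_dart[OF d] by (simp add: A_def)
  qed
  have "y \<in> top_part j"
  proof (rule top_partI)
    fix t assume t: "(y, t) \<in> above j"
    then have lab: "(y, t) \<in> R j \<or> (t, y) \<in> R (j + 1) \<or> (t, y) \<in> R (j - 1)" by (auto simp: above_def)
    then have "(y, t) \<in> darts T" using labelled_dart labelled_dart' by blast
    then have "t \<in> A" using \<open>A = neighbours T y\<close> by (simp add: neighbours_def)
    moreover have "t \<noteq> x"
    proof
      assume "t = x"
      then show False using lab x(1) label_asym[OF x(1)] label_unique[OF x(1), of j] by auto
    qed
    moreover have "(y, t) \<notin> R (j + 1)"
    proof
      assume "(y, t) \<in> R (j + 1)"
      then show False using lab label_asym label_unique[of y t "j + 1" j] by auto
    qed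
    moreover have "(t, y) \<notin> R j"
    proof
      assume "(t, y) \<in> R j"
      then show False
        using lab label_asym label_unique[of t y j "j + 1"] label_unique[of t y j "j - 1"] by auto
    qed
    ultimately show "t \<in> top_part j" by (simp add: A_def)
  qed
  then show False using y by blast
qed

lemma label_wf: "wf (R i)"
  by (rule finite_acyclic_wf[OF finite_label label_acyclic])

text \<open>A bad exit of \<open>x\<close> leads to a bad exit of a child of \<open>x\<close> in the tree of label \<open>j - 1\<close>.\<close>

lemma no_bad_exit: "\<not> bad_exit j x"
  using label_wf[of "j - 1"]
proof (induction x rule: wf_induct_rule)
  case (less x)
  show ?case
  proof
    assume "bad_exit j x"
    then obtain s where x: "x \<in> inner_verts T" "x \<notin> top_part j" and s: "(x, s) \<in> darts T" "s \<in> top_part j"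
      and y: "rot T x s \<notin> top_part j" "(rot T x s, x) \<in> R (j - 1)"
      unfolding bad_exit_def by blast
    have "rot T (rot T x s) x = s" using triangle(1)[OF s(1)] .
    then have "bad_exit j (rot T x s)"
      using bad_exitI[OF labelled_inner[OF y(2)] y] s(2) by simp
    then show False using less y(2) by blast
  qed
qed

text \<open>Around \<open>x\<close> some neighbour outside the top part is followed by one inside.
  By \<open>top_part_enter\<close> this yields a bad exit or a child of \<open>x\<close> in the tree
  of label \<open>j + 1\<close> that is again adjacent to the top part, and this descent
  ends.\<close>

lemma not_adjacent_top_part:
  "x \<in> inner_verts T \<longrightarrow> x \<notin> top_part j \<longrightarrow> (x, s) \<in> darts T \<longrightarrow> s \<notin> top_part j"
  using label_wf[of "j + 1"]
proof (induction x arbitrary: s rule: wf_induct_rule)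
  case (less x)
  show ?case
  proof (intro impI notI)
    assume x: "x \<in> inner_verts T" "x \<notin> top_part j" and s: "(x, s) \<in> darts T" "s \<in> top_part j"
    obtain v where v: "(x, v) \<in> R (j + 1)" using out_exists[OF x(1)] by blast
    then have "(v, x) \<in> above j" by (simp add: above_def)
    then have vS: "v \<notin> top_part j" using top_part_up x(2) by blast
    have "\<exists>y. (x, y) \<in> darts T \<and> y \<notin> top_part j \<and> rot T x y \<in> top_part j"
    proof (rule ccontr)
      assume not: "\<not> ?thesis"
      have "{y. (x, y) \<in> darts T \<and> y \<notin> top_part j} = neighbours T x"
      proof (rule rot_closed)
        show "v \<in> {y. (x, y) \<in> darts T \<and> y \<notin> top_part j}" using vS labelled_dart[OF v] by simp
        show "rot T x y \<in> {y. (x, y) \<in> darts T \<and> y \<notin> top_part j}"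
          if "y \<in> {y. (x, y) \<in> darts T \<and> y \<notin> top_part j}" for y
          using that not rot_dart[of x y] by blast
      qed (auto simp: neighbours_def)
      then show False using s unfolding neighbours_def by blast
    qed
    then obtain y where y: "(x, y) \<in> darts T" "y \<notin> top_part j" "rot T x y \<in> top_part j"
      by blast
    from top_part_enter[OF x y] show False
    proof
      assume "(x, y) \<in> R (j - 1)"
      then show False using bad_exitI[OF x _ y(3)] no_bad_exit by blast
    next
      assume yx: "(y, x) \<in> R (j + 1)"
      then show False using less[OF yx, of "rot T x y"] labelled_inner[OF yx] y triangle(4)[OF y(1)] by blast
    qed
  qed
qed

text \<open>On the path of label \<open>j\<close> from an inner vertex, membership is handed back
  from the root, since an inner vertex next to the top part belongs to it.\<close>

lemma top_part_all: "x \<in> top_part j"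
proof -
  have "wf ((R j)\<inverse>)" by (rule finite_acyclic_wf_converse[OF finite_label label_acyclic])
  then have inner: "x \<in> inner_verts T \<longrightarrow> x \<in> top_part j" for x
  proof (induction x rule: wf_induct_rule)
    case (less x)
    show ?case
    proof
      assume x: "x \<in> inner_verts T"
      then obtain y where y: "(x, y) \<in> R j" using out_exists by blast
      then have "y \<in> top_part j" using less root_target[OF y] root_top_part by (cases "y \<in> inner_verts T") auto
      then show "x \<in> top_part j" using not_adjacent_top_part x labelled_dart[OF y] by blast
    qed
  qed
  show ?thesis
  proof (rule top_partI)
    fix y assume "(x, y) \<in> above j"
    then have "x \<in> inner_verts T \<or> y \<in> inner_verts T" by (auto simp: above_def dest: labelled_inner)
    then show "y \<in> top_part j" using inner top_part_up \<open>(x, y) \<in> above j\<close> by blast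
  qed
qed

lemma above_acyclic: "acyclic (above j)"
proof -
  have "wf ((above j)\<inverse>)" using top_part_all unfolding top_part_def by (intro acc_wfI) simp
  then have "acyclic ((above j)\<inverse>)" by (rule wf_acyclic)
  then show ?thesis by (simp only: acyclic_converse)
qed

lemma height_function_exists:
  "\<exists>h. height_function R j h \<and> (\<forall>x. h x \<le> card (verts T))"
proof -
  \<comment> \<open>Counting the vertices below \<open>x\<close> bounds the heights by
    \<open>card (verts T)\<close>, which gives one factor of the final
    \<open>n\<^sup>2\<close>.\<close>
  define below where "below x = {y \<in> verts T. (y, x) \<in> (above j)\<^sup>+}" for x
  have fin: "finite (below x)" for x using finite_verts by (simp add: below_def)
  have less: "card (below x) < card (below y)" if xy: "(x, y) \<in> above j" for x y
  proof (rule psubset_card_mono[OF fin])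
    have "x \<in> verts T"
      using xy labelled_dart[of x y] labelled_dart[of y x] dart_verts[of x y] dart_verts[of y x]
      by (auto simp: above_def)
    then have "x \<in> below y" using xy by (auto simp: below_def)
    moreover have "x \<notin> below x" using above_acyclic by (auto simp: below_def acyclic_def)
    moreover have "below x \<subseteq> below y" unfolding below_def using xy by (blast intro: trancl_into_trancl)
    ultimately show "below x \<subset> below y" by blast
  qed
  have "height_function R j (\<lambda>x. card (below x))"
    using less by (auto simp: height_function_def above_def)
  moreover have "card (below x) \<le> card (verts T)" for x
    by (rule card_mono[OF finite_verts]) (auto simp: below_def)
  ultimately show ?thesis by blast
qed

end

section \<open>Colored flips\<close>

lemma cyclic_onI:
  assumes "S \<noteq> {}" "\<And>x. x \<in> S \<Longrightarrow> f x \<in> S"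
    and "\<And>A. A \<subseteq> S \<Longrightarrow> A \<noteq> {} \<Longrightarrow> (\<And>x. x \<in> A \<Longrightarrow> f x \<in> A) \<Longrightarrow> A = S"
  shows "cyclic_on f S"
proof -
  obtain s where s: "s \<in> S" using assms(1) by blast
  have "y \<in> S" if "y \<in> orbit f s" for y
    using that by induction (use s assms(2) in auto)
  then have "orbit f s = S"
    by (intro assms(3)) (auto simp: orbit_nonempty intro: orbit.intros)
  then show ?thesis using s by (auto simp: cyclic_on_def)
qed

lemma cyclic_on_remove:
  assumes f: "cyclic_on f N" and w: "w \<in> N" "f w = v" "w \<noteq> v"
  shows "cyclic_on (f(w := f v)) (N - {v})"
proof (rule cyclic_onI)
  have v: "v \<in> N" "f v \<in> N" using cyclic_on_inI[OF f] w by auto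
  have inj: "f x = f y \<Longrightarrow> x \<in> N \<Longrightarrow> y \<in> N \<Longrightarrow> x = y" for x y
    using cyclic_on_inj_on[OF f] by (auto dest: inj_onD)
  show "N - {v} \<noteq> {}" using w by blast
  show "(f(w := f v)) x \<in> N - {v}" if "x \<in> N - {v}" for x
    using that cyclic_on_inI[OF f] v w inj[of v w] inj[of x w] by auto
  fix A assume A: "A \<subseteq> N - {v}" "A \<noteq> {}" "\<And>x. x \<in> A \<Longrightarrow> (f(w := f v)) x \<in> A"
  show "A = N - {v}"
  proof (cases "w \<in> A")
    case True
    have "insert v A = N"
    proof (rule cyclic_on_closed[OF f])
      show "f x \<in> insert v A" if "x \<in> insert v A" for x
        using that A(3)[of x] A(3)[OF True] w by (cases "x = w") auto
    qed (use A v in auto)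
    then show ?thesis using A by auto
  next
    case False
    obtain a where a: "a \<in> A" using A by blast
    have "A = N"
    proof (rule cyclic_on_closed[OF f _ a])
      show "f x \<in> A" if "x \<in> A" for x using that A(3)[of x] False by (cases "x = w") auto
    qed (use A in auto)
    then show ?thesis using False w by blast
  qed
qed

lemma cyclic_on_insert:
  assumes f: "cyclic_on f N" and a: "a \<in> N" and z: "z \<notin> N"
  shows "cyclic_on (f(a := z, z := f a)) (insert z N)"
proof (rule cyclic_onI)
  have fN: "x \<in> N \<Longrightarrow> f x \<in> N" for x using cyclic_on_inI[OF f] .
  show "insert z N \<noteq> {}" by simp
  show "(f(a := z, z := f a)) x \<in> insert z N" if "x \<in> insert z N" for x
    using that fN a by auto
  fix A assume A: "A \<subseteq> insert z N" "A \<noteq> {}" "\<And>x. x \<in> A \<Longrightarrow> (f(a := z, z := f a)) x \<in> A"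
  have fa: "f a \<in> A" if "z \<in> A" using A(3)[OF that] by simp
  obtain b where b: "b \<in> A - {z}"
  proof (cases "A = {z}")
    case True
    then show ?thesis using fa fN[OF a] z by auto
  next
    case False
    then show ?thesis using that A by blast
  qed
  have "A - {z} = N"
  proof (rule cyclic_on_closed[OF f _ b])
    show "f x \<in> A - {z}" if x: "x \<in> A - {z}" for x
    proof (cases "x = a")
      case True
      then have "z \<in> A" using A(3)[of x] x by auto
      then show ?thesis using fa True fN[OF a] z by auto
    next
      case False
      then have "f x \<in> A" using A(3)[of x] x by auto
      moreover have "f x \<in> N" using fN x A by blast
      ultimately show ?thesis using z by auto
    qed
  qed (use A in auto)
  moreover have "z \<in> A" using A(3)[of a] a z calculation by auto
  ultimately show "A = insert z N" by auto
qed

text \<open>The flipped edge has label \<open>j - 1\<close> and \<open>wu\<close> has label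
  \<open>j\<close>, so the flip is of type \<open>f\<^sub>2\<close>. The heights belong to the
  configuration because they give both flippability and the acyclicity of the new labels.\<close>

locale raising_flip = schnyder_wood T R for T :: "'v outer_map" and R +
  fixes j u v w z h
  assumes triangulation: "triangulation T"
    and uv: "(u, v) \<in> R (j - 1)"
    and wu: "(w, u) \<in> R j"
    and rot_uw: "rot T u w = v"
    and rot_uv: "rot T u v = z"
    and height: "height_function R j h"
begin

abbreviation (input) T' where "T' \<equiv> diagonal_flip T u w v z"

definition R' where
  "R' = R(j - 1 := R (j - 1) - {(u, v)} \<union> {(u, w)}, j := R j - {(w, u)} \<union> {(w, z)})"

lemma height_up: "(x, y) \<in> R j \<Longrightarrow> h x < h y"
  and height_down: "(x, y) \<in> R (j + 1) \<Longrightarrow> h y < h x" "(x, y) \<in> R (j - 1) \<Longrightarrow> h y < h x"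
  using height by (auto simp: height_function_def)

lemma inner_uw: "u \<in> inner_verts T" "w \<in> inner_verts T"
  using labelled_inner uv wu by auto

lemma old_darts:
  "(u, v) \<in> darts T" "(v, u) \<in> darts T" "(u, w) \<in> darts T" "(w, u) \<in> darts T"
  "(v, w) \<in> darts T" "(w, v) \<in> darts T" "(u, z) \<in> darts T" "(z, u) \<in> darts T"
  "(v, z) \<in> darts T" "(z, v) \<in> darts T"
proof -
  show 1: "(u, v) \<in> darts T" "(u, w) \<in> darts T" "(v, u) \<in> darts T" "(w, u) \<in> darts T"
    using labelled_dart labelled_dart' uv wu by auto
  show "(v, w) \<in> darts T" "(w, v) \<in> darts T" using triangle(4,5)[OF 1(2)] rot_uw by auto
  show "(v, z) \<in> darts T" "(z, v) \<in> darts T" "(u, z) \<in> darts T" "(z, u) \<in> darts T"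
    using triangle(3-6)[OF 1(1)] rot_uv by auto
qed

lemma old_rot: "rot T v u = w" "rot T w v = u" "rot T z u = v" "rot T v z = u"
  using triangle(1,2)[OF old_darts(3)] triangle(1,2)[OF old_darts(1)] rot_uw rot_uv by auto

lemma label_uz: "(z, u) \<in> R (j + 1) \<or> (u, z) \<in> R j"
  using succ_out[OF uv] rot_uv by simp

lemma label_vw: "(v, w) \<in> R (j + 1) \<or> (w, v) \<in> R (j - 1)"
  using pred_out[of w v j] old_rot wu old_darts by simp

text \<open>The edge between \<open>v\<close> and \<open>z\<close> may join two roots and then has
  no label; otherwise the rule at an inner end restricts it.\<close>

lemma label_vz: "v \<in> inner_verts T \<or> z \<in> inner_verts T \<Longrightarrow> (v, z) \<in> R j \<or> (z, v) \<in> R (j - 1)"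
proof (elim disjE)
  assume "v \<in> inner_verts T"
  then show ?thesis using pred_in[of v z "j - 1"] old_rot uv old_darts by auto
next
  assume z: "z \<in> inner_verts T"
  from label_uz show ?thesis
  proof
    assume "(z, u) \<in> R (j + 1)"
    then show ?thesis using succ_out[of z u "j + 1"] old_rot by auto
  next
    assume "(u, z) \<in> R j"
    then show ?thesis using succ_in[of u z j] z old_rot by auto
  qed
qed

lemma height_wu: "h w < h u" and height_uz: "h u < h z"
  using height_up[OF wu] label_uz height_up height_down by auto

text \<open>
  Around \<open>w\<close>, the heights of the incoming neighbours of labels \<open>j + 1\<close> and \<open>j - 1\<close> increase
  towards the outgoing edge of label \<open>j\<close>.
\<close>

lemma height_incoming:
  assumes "(x, w) \<in> R (j + 1) \<or> (x, w) \<in> R (j - 1)"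
  shows "h x < h u"
proof (rule ccontr)
  assume "\<not> h x < h u"
  define A where "A = {x. ((x, w) \<in> R (j + 1) \<or> (x, w) \<in> R (j - 1)) \<and> h u \<le> h x}"
  have "x \<in> A" using assms \<open>\<not> h x < h u\<close> by (simp add: A_def)
  moreover have "finite A"
  proof (rule finite_subset[OF _ finite_verts])
    show "A \<subseteq> verts T" using labelled_dart dart_verts unfolding A_def by blast
  qed
  ultimately have "finite (h ` A)" "h ` A \<noteq> {}" by auto
  \<comment> \<open>The neighbour of \<open>w\<close> one step closer to \<open>u\<close> is higher
    than \<open>m\<close>, hence not \<open>u\<close>. So it is incoming with the same label,
    against the choice of \<open>m\<close>.\<close>
  then obtain m where m: "m \<in> A" "\<And>y. y \<in> A \<Longrightarrow> h y \<le> h m"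
    using Max_in[of "h ` A"] Max_ge[of "h ` A"] by fastforce
  have mh: "h u \<le> h m" using m(1) by (simp add: A_def)
  from m(1) consider "(m, w) \<in> R (j + 1)" | "(m, w) \<in> R (j - 1)" by (auto simp: A_def)
  then show False
  proof cases
    case 1
    note d = labelled_dart'[OF 1]
    define y where "y = rot T w m"
    have "rot T m y = w" "(m, y) \<in> darts T" using triangle(2,4)[OF d] by (simp_all add: y_def)
    then have "(y, m) \<in> R (j - 1) \<or> (m, y) \<in> R j" using pred_out[of m y "j + 1"] 1 by simp
    then have up: "h m < h y" using height_up height_down by auto
    have "(y, w) \<in> R (j + 1) \<or> (w, y) \<in> R j" using succ_in[OF 1 inner_uw(2)] by (simp add: y_def)
    moreover have "y \<noteq> u" using up mh by auto
    ultimately have "(y, w) \<in> R (j + 1)" using out_unique[OF wu] by blast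
    then have "y \<in> A" using up mh by (simp add: A_def)
    then show False using m(2) up by fastforce
  next
    case 2
    obtain y where y: "(w, y) \<in> darts T" "rot T w y = m" using rot_surj[OF labelled_dart'[OF 2]] by blast
    have "rot T m w = y" using triangle(1)[OF y(1)] y(2) by simp
    then have "(y, m) \<in> R (j + 1) \<or> (m, y) \<in> R j" using succ_out[OF 2] by auto
    then have up: "h m < h y" using height_up height_down by auto
    have "(y, w) \<in> R (j - 1) \<or> (w, y) \<in> R j" using pred_in[of w y "j - 1"] 2 inner_uw(2) y by simp
    moreover have "y \<noteq> u" using up mh by auto
    ultimately have "(y, w) \<in> R (j - 1)" using out_unique[OF wu] by blast
    then have "y \<in> A" using up mh by (simp add: A_def)
    then show False using m(2) up by fastforce
  qed
qed

lemma distinct: "u \<noteq> v" "u \<noteq> w" "u \<noteq> z" "v \<noteq> w" "v \<noteq> z" "w \<noteq> z"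
  using old_darts height_wu height_uz dart_irrefl by (metis, metis, metis, metis, metis, metis less_asym)

text \<open>An outgoing edge of label \<open>j\<close> at \<open>w\<close> ends at \<open>u\<close>.
  Outgoing edges of the other labels and incoming ones of label \<open>j\<close> lead to vertices
  below \<open>w\<close>, and the remaining neighbours lie below \<open>u\<close> by
  \<open>height_incoming\<close>; but \<open>z\<close> lies above \<open>u\<close>.\<close>

lemma wz_not_dart: "(w, z) \<notin> darts T" "(z, w) \<notin> darts T"
proof -
  show "(w, z) \<notin> darts T"
  proof
    assume "(w, z) \<in> darts T"
    then obtain k where k: "(w, z) \<in> R k \<or> (z, w) \<in> R k" using label_exists inner_uw by blast
    from k show False
    proof
      assume wz: "(w, z) \<in> R k"
      have "k \<noteq> j" using out_unique[OF wu] wz distinct by auto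
      then have "h z < h w" using label_cases[of k j] wz height_down by auto
      then show False using height_wu height_uz by simp
    next
      assume zw: "(z, w) \<in> R k"
      show False using label_cases[of k j] zw height_up[of z w] height_incoming[of z] height_wu height_uz by auto
    qed
  qed
  then show "(z, w) \<notin> darts T" using dart_sym by blast
qed

section \<open>The flipped triangulation\<close>

lemma flip_verts [simp]: "verts T' = verts T" "root T' = root T" "inner_verts T' = inner_verts T"
  by (simp_all add: diagonal_flip_def inner_verts_def)

lemma flip_darts: "darts T' = darts T - {(u, v), (v, u)} \<union> {(w, z), (z, w)}"
  by (simp add: diagonal_flip_def)

lemma flip_rot:
  "rot T' u w = z" "rot T' v z = w" "rot T' w v = z" "rot T' w z = u" "rot T' z u = w" "rot T' z w = v"
  "(b, a) \<notin> {(u, w), (v, z), (w, v), (w, z), (z, u), (z, w)} \<Longrightarrow> rot T' b a = rot T b a"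
  using distinct by (auto simp: diagonal_flip_def)

lemma flip_rot_eq:
  "rot T' u = (rot T u)(w := z)" "rot T' v = (rot T v)(z := w)"
  "rot T' w = (rot T w)(v := z, z := u)" "rot T' z = (rot T z)(u := w, w := v)"
  "x \<notin> {u, v, w, z} \<Longrightarrow> rot T' x = rot T x"
  using distinct by (auto simp: diagonal_flip_def)

lemma flip_rotation: "rotation_system T'"
  unfolding rotation_system_def flip_verts
proof (intro conjI ballI impI)
  have V: "u \<in> verts T" "v \<in> verts T" "w \<in> verts T" "z \<in> verts T"
    using dart_verts old_darts by blast+
  show "finite (verts T)" by (rule finite_verts)
  show "darts T' \<subseteq> verts T \<times> verts T" using V dart_verts by (auto simp: flip_darts)
  show "sym (darts T')" using dart_sym by (auto simp: flip_darts sym_def)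
  show "irrefl (darts T')" using distinct by (auto simp: flip_darts irrefl_def)
  fix x assume x: "x \<in> verts T" "neighbours T' x \<noteq> {}"
  note cyc = cyclic_on_rot[OF rotation]
  consider "x = u" | "x = v" | "x = w" | "x = z" | "x \<notin> {u, v, w, z}" by blast
  then show "cyclic_on (rot T' x) (neighbours T' x)"
  proof cases
    case 1
    have "neighbours T' u = neighbours T u - {v}" using distinct by (auto simp: neighbours_def flip_darts)
    then show ?thesis using cyclic_on_remove[OF cyc[OF old_darts(1)], of w v] old_darts distinct 1
      by (simp add: flip_rot_eq rot_uw rot_uv neighbours_def)
  next
    case 2
    have "neighbours T' v = neighbours T v - {u}" using distinct by (auto simp: neighbours_def flip_darts)
    then show ?thesis using cyclic_on_remove[OF cyc[OF old_darts(2)], of z u] old_darts distinct 2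
      by (simp add: flip_rot_eq old_rot neighbours_def)
  next
    case 3
    have "neighbours T' w = insert z (neighbours T w)" using distinct by (auto simp: neighbours_def flip_darts)
    then show ?thesis using cyclic_on_insert[OF cyc[OF old_darts(4)], of v z] old_darts wz_not_dart 3
      by (simp add: flip_rot_eq old_rot neighbours_def)
  next
    case 4
    have "neighbours T' z = insert w (neighbours T z)" using distinct by (auto simp: neighbours_def flip_darts)
    then show ?thesis using cyclic_on_insert[OF cyc[OF old_darts(8)], of u w] old_darts wz_not_dart 4
      by (simp add: flip_rot_eq old_rot neighbours_def)
  next
    case 5
    then have N: "neighbours T' x = neighbours T x" by (auto simp: neighbours_def flip_darts)
    then obtain y where "(x, y) \<in> darts T" using x by (auto simp: neighbours_def)
    from cyc[OF this] show ?thesis unfolding N flip_rot_eq(5)[OF 5] .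
  qed
qed

lemma flip_triangles: "triangle_faces T'"
  unfolding triangle_faces_def
proof (intro allI impI)
  fix a b assume ab: "(a, b) \<in> darts T'"
  \<comment> \<open>The six corners of the two faces at the new edge \<open>wz\<close>; elsewhere
    the rotation is the old one.\<close>
  let ?C = "{(u, w), (v, z), (w, v), (w, z), (z, u), (z, w)}"
  show "rot T' (rot T' b a) b = a"
  proof (cases "(b, a) \<in> ?C")
    case True
    then show ?thesis using flip_rot(1-6) by auto
  next
    case False
    then have ba: "(b, a) \<in> darts T" "(b, a) \<noteq> (u, v)" "(b, a) \<noteq> (v, u)"
      using ab dart_sym by (auto simp: flip_darts)
    define c where "c = rot T b a"
    have c: "rot T' b a = c" using flip_rot(7)[OF False] by (simp add: c_def)
    have cb: "rot T c b = a" "(c, b) \<in> darts T" using triangle(1,6)[OF ba(1)] by (simp_all add: c_def)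
    have "(c, b) \<notin> ?C"
      using cb False ba wz_not_dart rot_uw old_rot by auto
    then have "rot T' c b = a" using flip_rot(7) cb by simp
    then show ?thesis using c by simp
  qed
qed

lemma flip_triangulation: "triangulation T'"
proof -
  have sub: "darts T \<subseteq> (darts T')\<^sup>*"
  proof (rule subrelI)
    fix x y assume xy: "(x, y) \<in> darts T"
    have "(u, w) \<in> darts T'" "(w, v) \<in> darts T'" "(v, w) \<in> darts T'" "(w, u) \<in> darts T'"
      using old_darts distinct by (auto simp: flip_darts)
    then have "(u, v) \<in> (darts T')\<^sup>*" "(v, u) \<in> (darts T')\<^sup>*"
      by (meson r_into_rtrancl rtrancl_trans)+
    then show "(x, y) \<in> (darts T')\<^sup>*"
      using xy by (cases "(x, y) = (u, v) \<or> (x, y) = (v, u)") (auto simp: flip_darts)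
  qed
  have con: "connected_map T'"
    using triangulation rtrancl_subset_rtrancl[OF sub]
    unfolding triangulation_iff connected_map_def flip_verts by blast
  have fin: "finite (darts T)" by (rule finite_darts[OF rotation])
  have "card (darts T') = card (darts T - {(u, v), (v, u)}) + card {(w, z), (z, w)}"
    unfolding flip_darts using fin wz_not_dart by (intro card_Un_disjoint) auto
  also have "\<dots> = card (darts T) - card {(u, v), (v, u)} + card {(w, z), (z, w)}"
    using old_darts fin by (subst card_Diff_subset) auto
  also have "\<dots> = card (darts T)"
    using card_mono[OF fin, of "{(u, v), (v, u)}"] old_darts distinct by simp
  finally have card: "card (darts T') = card (darts T)" .
  obtain a b where ab: "(a, b) \<in> darts T" "{a, b, rot T b a} = range (root T)"
    using triangulation unfolding triangulation_iff by blast
  have no: "u \<notin> range (root T)" "w \<notin> range (root T)" using inner_uw by (auto simp: inner_verts_def)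
  \<comment> \<open>Each corner in the list involves \<open>u\<close> or \<open>w\<close>, which are
    inner, except \<open>(v, z)\<close>, whose old face has \<open>u\<close> as third vertex. So the
    outer face survives.\<close>
  have "(b, a) \<notin> {(u, w), (v, z), (w, v), (w, z), (z, u), (z, w)}"
    using ab(2) no old_rot by auto
  then have "rot T' b a = rot T b a" by (rule flip_rot(7))
  moreover have "(a, b) \<in> darts T'" using ab no by (auto simp: flip_darts)
  ultimately have "\<exists>a b. (a, b) \<in> darts T' \<and> {a, b, rot T' b a} = range (root T')"
    using ab(2) flip_verts(2) by metis
  then show ?thesis
    using triangulation flip_rotation flip_triangles con card unfolding triangulation_iff by simp
qed

section \<open>The flipped labels\<close>

lemma R'_iff: "(x, y) \<in> R' k \<longleftrightarrow>
    (x, y) \<in> R k \<and> (x, y) \<noteq> (u, v) \<and> (x, y) \<noteq> (w, u) \<or>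
    k = j - 1 \<and> (x, y) = (u, w) \<or> k = j \<and> (x, y) = (w, z)"
proof -
  have "(u, v) \<in> R k \<longleftrightarrow> k = j - 1" "(w, u) \<in> R k \<longleftrightarrow> k = j"
    using uv wu label_unique by blast+
  then show ?thesis using distinct by (auto simp: R'_def)
qed

lemma R'_other: "R' (j + 1) = R (j + 1)"
  by (simp add: R'_def)

lemma new_labels: "(u, w) \<notin> R k" "(v, u) \<notin> R k" "(w, z) \<notin> R k" "(z, w) \<notin> R k"
  using label_asym uv wu wz_not_dart labelled_dart by blast+

lemma R'_height: "height_function R' j h"
proof -
  have "h x < h y" if "(x, y) \<in> R' j" for x y
    using that height_up height_wu height_uz by (auto simp: R'_iff)
  moreover have "h y < h x" if "(x, y) \<in> R' (j + 1) \<or> (x, y) \<in> R' (j - 1)" for x y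
    using that height_down height_wu by (auto simp: R'_iff)
  ultimately show ?thesis by (simp add: height_function_def)
qed

lemma R'_unique: "(x, y) \<in> R' k \<Longrightarrow> (x, y) \<in> R' l \<Longrightarrow> k = l"
  using label_unique[of x y k l] new_labels distinct by (auto simp: R'_iff)

lemma R'_asym: "(x, y) \<in> R' k \<Longrightarrow> (y, x) \<notin> R' l"
  using label_asym[of x y k l] new_labels distinct by (auto simp: R'_iff)

text \<open>\<open>succ_out\<close> and \<open>succ_in\<close> at a single corner, for an arbitrary
  labelling, so that the rules of \<open>R\<close> can be carried over to \<open>R'\<close>.\<close>

definition rules :: "(3 \<Rightarrow> ('v \<times> 'v) set) \<Rightarrow> 'v \<Rightarrow> 'v \<Rightarrow> 'v \<Rightarrow> bool" where
  "rules S x y y' \<longleftrightarrow> (\<forall>k. ((x, y) \<in> S k \<longrightarrow> (y', x) \<in> S (k - 1) \<or> (x, y') \<in> S (k + 1)) \<and>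
     ((y, x) \<in> S k \<longrightarrow> (y', x) \<in> S k \<or> (x, y') \<in> S (k - 1)))"

lemma rules_outI:
  "(x, y) \<in> R' k \<Longrightarrow> (y', x) \<in> R' (k - 1) \<or> (x, y') \<in> R' (k + 1) \<Longrightarrow> rules R' x y y'"
  unfolding rules_def using R'_unique R'_asym by metis

lemma rules_inI:
  "(y, x) \<in> R' k \<Longrightarrow> (y', x) \<in> R' k \<or> (x, y') \<in> R' (k - 1) \<Longrightarrow> rules R' x y y'"
  unfolding rules_def using R'_unique R'_asym by metis

lemma R'_kept:
  assumes "(x, y) \<notin> {(u, v), (v, u), (u, w), (w, u), (w, z), (z, w)}"
  shows "(x, y) \<in> R' k \<longleftrightarrow> (x, y) \<in> R k" "(y, x) \<in> R' k \<longleftrightarrow> (y, x) \<in> R k"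
  using assms by (auto simp: R'_iff)

lemma R'_labels:
  "(u, w) \<in> R' (j - 1)" "(w, z) \<in> R' j"
  "(z, u) \<in> R' (j + 1) \<or> (u, z) \<in> R' j"
  "(v, w) \<in> R' (j + 1) \<or> (w, v) \<in> R' (j - 1)"
  "v \<in> inner_verts T \<or> z \<in> inner_verts T \<Longrightarrow> (v, z) \<in> R' j \<or> (z, v) \<in> R' (j - 1)"
  using label_uz label_vw label_vz distinct by (auto simp: R'_iff)

text \<open>Besides the six new corners, those at the reversed edge between \<open>w\<close> and
  \<open>u\<close> need care. At \<open>w\<close>, an outgoing edge of label \<open>j\<close> and an
  incoming one of label \<open>j - 1\<close> admit the same successors; at \<open>u\<close>, an
  incoming edge of label \<open>j\<close> and an outgoing one of label \<open>j - 1\<close> admit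
  the same predecessors.\<close>

lemma flip_rules:
  assumes x: "x \<in> inner_verts T" and xy: "(x, y) \<in> darts T'"
  shows "rules R' x y (rot T' x y)"
proof -
  consider "(x, y) = (u, w)" | "(x, y) = (v, z)" | "(x, y) = (w, v)" | "(x, y) = (w, z)"
    | "(x, y) = (z, u)" | "(x, y) = (z, w)"
    | (old) "(x, y) \<notin> {(u, w), (v, z), (w, v), (w, z), (z, u), (z, w)}" by blast
  then show ?thesis
  proof cases
    case 1
    then show ?thesis using rules_outI[of u w "j - 1" z] R'_labels flip_rot by auto
  next
    case 2
    then show ?thesis
      using R'_labels(5) x rules_outI[of v z j w] rules_inI[of z v "j - 1" w] R'_labels(4) flip_rot by auto
  next
    case 3
    then show ?thesis
      using R'_labels(4) rules_inI[of v w "j + 1" z] rules_outI[of w v "j - 1" z] R'_labels(2) flip_rot by auto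
  next
    case 4
    then show ?thesis using rules_outI[of w z j u] R'_labels(1,2) flip_rot by auto
  next
    case 5
    then show ?thesis
      using R'_labels(3) rules_outI[of z u "j + 1" w] rules_inI[of u z j w] R'_labels(2) flip_rot by auto
  next
    case 6
    then show ?thesis using rules_inI[of w z j v] R'_labels(2,5) x flip_rot by auto
  next
    case old
    define y' where "y' = rot T x y"
    have rot: "rot T' x y = y'" using flip_rot(7)[OF old] by (simp add: y'_def)
    have xy_old: "(x, y) \<in> darts T" "(x, y) \<noteq> (u, v)" "(x, y) \<noteq> (v, u)"
      using xy old by (auto simp: flip_darts)
    have xy': "(x, y') \<in> darts T" using rot_dart[OF xy_old(1)] by (simp add: y'_def)
    have rules: "rules R x y y'"
      unfolding rules_def y'_def using succ_out succ_in x by blast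
    have inj: "y = t" if "y' = rot T x t" "(x, t) \<in> darts T" for t
      using rot_inj[OF xy_old(1) that(2)] that(1) by (simp add: y'_def)
    have "rules R' x y y'"
    proof (cases "(x, y) = (w, u)")
      case True
      then have "(y', w) \<in> R (j - 1) \<or> (w, y') \<in> R (j + 1)" using rules wu by (auto simp: rules_def)
      moreover have "y' \<noteq> u" "y' \<noteq> z" using inj[of v] old_rot old_darts True distinct xy' wz_not_dart by auto
      ultimately have "(y', w) \<in> R' (j - 1) \<or> (w, y') \<in> R' (j + 1)"
        by (auto simp: R'_iff distinct distinct[symmetric])
      then show ?thesis using rules_inI[of u w "j - 1" y'] R'_labels(1) True by auto
    next
      case ne: False
      have kept: "(x, y) \<in> R' k \<longleftrightarrow> (x, y) \<in> R k" "(y, x) \<in> R' k \<longleftrightarrow> (y, x) \<in> R k" for k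
      proof -
        have "(x, y) \<notin> {(u, v), (v, u), (u, w), (w, u), (w, z), (z, w)}" using ne old xy_old by blast
        from R'_kept[OF this]
        show "(x, y) \<in> R' k \<longleftrightarrow> (x, y) \<in> R k" "(y, x) \<in> R' k \<longleftrightarrow> (y, x) \<in> R k" .
      qed
      obtain k where k: "(x, y) \<in> R k \<or> (y, x) \<in> R k" using label_exists[OF xy_old(1) x] by blast
      show ?thesis
      proof (cases "(x, y') = (u, w)")
        case True
        from k show ?thesis
        proof
          assume xk: "(x, y) \<in> R k"
          then have "k = j + 1"
            using rules True wu label_asym label_unique[OF wu, of "k - 1"] by (auto simp: rules_def)
          then show ?thesis using rules_outI[of x y "j + 1" w] xk kept R'_labels(1) True by auto
        next
          assume xk: "(y, x) \<in> R k"
          then have "k = j"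
            using rules True wu label_asym label_unique[OF wu, of k] by (auto simp: rules_def)
          then show ?thesis using rules_inI[of y x j w] xk kept R'_labels(1) True by auto
        qed
      next
        case False
        have "(x, y') \<noteq> (w, u)" using inj[of v] old_rot(2) old_darts(6) old by auto
        moreover have "(x, y') \<noteq> (u, v)" using inj[of w] rot_uw old_darts(3) old by auto
        moreover have "(x, y') \<noteq> (v, u)" using inj[of z] old_rot(4) old_darts(9) old by auto
        moreover have "(x, y') \<noteq> (w, z)" "(x, y') \<noteq> (z, w)" using xy' wz_not_dart by auto
        ultimately have "(x, y') \<notin> {(u, v), (v, u), (u, w), (w, u), (w, z), (z, w)}"
          using False by blast
        note kept' = R'_kept[OF this]
        show ?thesis using rules unfolding rules_def kept kept' .
      qed
    qed
    then show ?thesis using rot by simp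
  qed
qed

text \<open>Settles the one global condition on the new labels. The sign in the first case turns the
  increasing heights into the decreasing values that the order criterion asks for.\<close>

lemma acyclic_if_height:
  assumes "height_function S j h"
  shows "acyclic (S k)"
proof -
  consider "k = j" | "k = j + 1 \<or> k = j - 1" using label_cases by blast
  then show ?thesis
  proof cases
    case 1
    then show ?thesis using assms
      by (intro acyclicI_order[of _ "\<lambda>x. - int (h x)"]) (auto simp: height_function_def)
  next
    case 2
    then show ?thesis using assms by (intro acyclicI_order[of _ h]) (auto simp: height_function_def)
  qed
qed

lemma flip_schnyder_wood: "schnyder_wood T' R'"
proof
  show "rotation_system T'" "triangle_faces T'" by (rule flip_rotation flip_triangles)+
  show dart: "(x, y) \<in> darts T'" if "(x, y) \<in> R' k" for x y k
    using that labelled_dart[of x y k] old_darts distinct new_labels by (auto simp: R'_iff flip_darts)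
  show inner: "x \<in> inner_verts T'" if "(x, y) \<in> R' k" for x y k
    using that labelled_inner[of x y k] inner_uw by (auto simp: R'_iff)
  show "\<exists>k. (x, y) \<in> R' k \<or> (y, x) \<in> R' k" if xy: "(x, y) \<in> darts T'" and x: "x \<in> inner_verts T'" for x y
  proof (cases "(x, y) \<in> {(w, z), (z, w), (u, w), (w, u)}")
    case True
    then show ?thesis using R'_labels(1,2) by blast
  next
    case False
    then obtain k where "(x, y) \<in> R k \<or> (y, x) \<in> R k" "(x, y) \<noteq> (u, v)" "(x, y) \<noteq> (v, u)"
      using label_exists[of x y] xy x by (auto simp: flip_darts)
    then show ?thesis using False R'_kept[of x y] by blast
  qed
  show "k = l" if "(x, y) \<in> R' k" "(x, y) \<in> R' l" for x y k l using R'_unique that .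
  show "(y, x) \<notin> R' l" if "(x, y) \<in> R' k" for x y k l using R'_asym that .
  show "\<exists>y. (x, y) \<in> R' k" if x: "x \<in> inner_verts T'" for x k
  proof -
    obtain y where y: "(x, y) \<in> R k" using out_exists x by auto
    consider "(x, y) = (u, v)" | "(x, y) = (w, u)" | "(x, y) \<noteq> (u, v)" "(x, y) \<noteq> (w, u)" by blast
    then show ?thesis
    proof cases
      case 1
      then have "k = j - 1" using y uv label_unique by blast
      then show ?thesis using R'_labels(1) 1 by blast
    next
      case 2
      then have "k = j" using y wu label_unique by blast
      then show ?thesis using R'_labels(2) 2 by blast
    next
      case 3
      then show ?thesis using y R'_iff by blast
    qed
  qed
  show "y = y'" if "(x, y) \<in> R' k" "(x, y') \<in> R' k" for x y y' k
    using that out_unique[of x y k y'] out_unique[OF uv, of y] out_unique[OF wu, of y]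
      out_unique[OF uv, of y'] out_unique[OF wu, of y'] by (auto simp: R'_iff)
  show "(rot T' x y, x) \<in> R' (k - 1) \<or> (x, rot T' x y) \<in> R' (k + 1)" if "(x, y) \<in> R' k" for x y k
    using flip_rules[of x y] inner[OF that] dart[OF that] that by (simp add: rules_def)
  show "(rot T' x y, x) \<in> R' k \<or> (x, rot T' x y) \<in> R' (k - 1)"
    if yx: "(y, x) \<in> R' k" and x: "x \<in> inner_verts T'" for x y k
  proof -
    have "(x, y) \<in> darts T'" using dart[OF yx] flip_rotation unfolding rotation_system_def by (blast dest: symD)
    then show ?thesis using flip_rules[of x y] x yx by (simp add: rules_def)
  qed
  \<comment> \<open>For the new edge from \<open>w\<close> to \<open>z\<close>: if \<open>z\<close>
    is outer, the edge between \<open>u\<close> and \<open>z\<close> must leave \<open>u\<close>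
    with label \<open>j\<close>, so \<open>z\<close> is the root of label \<open>j\<close>.\<close>
  show "y = root T' k" if "(x, y) \<in> R' k" "y \<notin> inner_verts T'" for x y k
    using that root_target[of x y k] root_target[of u z j] label_uz labelled_inner[of z u] inner_uw
    by (auto simp: R'_iff)
  show "acyclic (R' k)" for k using acyclic_if_height[OF R'_height] .
  show "inj (root T')" using inj_root by simp
qed

lemma colored_flip: "colored_flip (T, R) (T', R')"
proof -
  have "quadrilateral T u w v z"
    using old_darts rot_uw rot_uv by (simp add: quadrilateral_def)
  moreover have "realizer T' R'" by (rule schnyder_wood.realizer[OF flip_schnyder_wood])
  moreover have "j = (j - 1) + 1" by simp
  ultimately show ?thesis
    unfolding colored_flip_def prod.case
    using realizer uv wu wz_not_dart(1) R'_def by blast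
qed

end

section \<open>Stars\<close>

text \<open>Supplies the configuration of \<open>raising_flip\<close>. If the run of incoming edges
  of label \<open>j\<close> never ended, it would fill the whole rotation, which also contains
  outgoing edges.\<close>

lemma (in schnyder_wood) last_incoming:
  assumes u: "u \<in> inner_verts T" and x: "(x, u) \<in> R j"
  shows "\<exists>w v. (w, u) \<in> R j \<and> rot T u w = v \<and> (u, v) \<in> R (j - 1)"
proof (rule ccontr)
  assume not: "\<not> ?thesis"
  have "{w. (w, u) \<in> R j} = neighbours T u"
  proof (rule rot_closed)
    show "{w. (w, u) \<in> R j} \<subseteq> neighbours T u" using labelled_dart' by (auto simp: neighbours_def)
    show "x \<in> {w. (w, u) \<in> R j}" using x by simp
    show "rot T u w \<in> {w. (w, u) \<in> R j}" if "w \<in> {w. (w, u) \<in> R j}" for w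
      using that not succ_in[of w u j] u by blast
  qed
  moreover obtain v where v: "(u, v) \<in> R j" using out_exists[OF u] by blast
  ultimately have "(v, u) \<in> R j" using labelled_dart[OF v] by (auto simp: neighbours_def)
  then show False using label_asym[OF v] by blast
qed

text \<open>Adds to \<open>colored_flip\<close> what keeps the target in
  \<open>realizer_set n\<close>.\<close>

definition flip_step :: "'v realized \<Rightarrow> 'v realized \<Rightarrow> bool" where
  "flip_step P Q \<longleftrightarrow> colored_flip P Q \<and> triangulation (fst Q) \<and> verts (fst Q) = verts (fst P)"

definition star :: "('v \<times> 'v) set \<Rightarrow> 'v \<Rightarrow> bool" where
  "star E r \<longleftrightarrow> (\<forall>x y. (x, y) \<in> E \<longrightarrow> y = r)"

text \<open>The sum is a potential for one fixed height function: a flip exchanges the summand of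
  the target \<open>u\<close> for that of the higher vertex \<open>z\<close>, so the sum drops by at
  least one.\<close>

lemma raise_to_star:
  assumes "triangulation T" "schnyder_wood T R" "height_function R j h" "\<forall>x. h x \<le> N"
  shows "\<exists>T' R' k. (flip_step ^^ k) (T, R) (T', R') \<and> k \<le> (\<Sum>(x, y)\<in>R j. N - h y) \<and>
    triangulation T' \<and> schnyder_wood T' R' \<and> star (R' j) (root T' j) \<and>
    verts T' = verts T \<and> root T' = root T \<and> R' (j + 1) = R (j + 1)"
  using assms
proof (induction "\<Sum>(x, y)\<in>R j. N - h y" arbitrary: T R rule: less_induct)
  case (less R T)
  note T = less.prems(1) and N = less.prems(4)
  interpret schnyder_wood T R by (rule less.prems(2))
  show ?case
  proof (cases "star (R j) (root T j)")
    case True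
    then have "(flip_step ^^ 0) (T, R) (T, R) \<and> 0 \<le> (\<Sum>(x, y)\<in>R j. N - h y) \<and>
      triangulation T \<and> schnyder_wood T R \<and> star (R j) (root T j) \<and>
      verts T = verts T \<and> root T = root T \<and> R (j + 1) = R (j + 1)"
      using less.prems by simp
    then show ?thesis by blast
  next
    case False
    then obtain x u where x: "(x, u) \<in> R j" "u \<noteq> root T j" by (auto simp: star_def)
    then have "u \<in> inner_verts T" using root_target by blast
    from last_incoming[OF this x(1)] obtain w v where
      w: "(w, u) \<in> R j" "rot T u w = v" "(u, v) \<in> R (j - 1)" by blast
    interpret raising_flip T R j u v w "rot T u v" h
      by unfold_locales (use w T less.prems in auto)
    define z where "z = rot T u v"
    define T2 where "T2 = diagonal_flip T u w v z"
    define R2 where "R2 = R(j - 1 := R (j - 1) - {(u, v)} \<union> {(u, w)}, j := R j - {(w, u)} \<union> {(w, z)})"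
    have R2: "R' = R2" by (simp add: R'_def R2_def z_def)
    have t2: "triangulation T2" "schnyder_wood T2 R2" "height_function R2 j h"
      "colored_flip (T, R) (T2, R2)" "verts T2 = verts T" "root T2 = root T" "R2 (j + 1) = R (j + 1)"
      using flip_triangulation flip_schnyder_wood R'_height colored_flip R'_other
      unfolding R2 by (simp_all add: T2_def z_def)
    have "(w, z) \<notin> R j" using new_labels(3) by (simp add: z_def)
    then have "(\<Sum>(x, y)\<in>R2 j. N - h y) = (N - h z) + (\<Sum>(x, y)\<in>R j - {(w, u)}. N - h y)"
      using finite_label by (simp add: R2_def)
    moreover have "(\<Sum>(x, y)\<in>R j. N - h y) = (N - h u) + (\<Sum>(x, y)\<in>R j - {(w, u)}. N - h y)"
      using sum.remove[OF finite_label w(1), of "\<lambda>(x, y). N - h y"] by simp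
    \<comment> \<open>The bound on \<open>h z\<close> matters because differences of naturals are
      cut off at 0.\<close>
    moreover have "h u < h z" "h z \<le> N" using height_uz N by (simp_all add: z_def)
    ultimately have "(\<Sum>(x, y)\<in>R2 j. N - h y) < (\<Sum>(x, y)\<in>R j. N - h y)" by linarith
    from less.hyps[OF this t2(1-3) N] obtain T' R' k where
      k: "(flip_step ^^ k) (T2, R2) (T', R')" "k \<le> (\<Sum>(x, y)\<in>R2 j. N - h y)" and
      T': "triangulation T'" "schnyder_wood T' R'" "star (R' j) (root T' j)"
        "verts T' = verts T2" "root T' = root T2" "R' (j + 1) = R2 (j + 1)"
      by blast
    have "flip_step (T, R) (T2, R2)" using t2 by (simp add: flip_step_def)
    then have "(flip_step ^^ Suc k) (T, R) (T', R')" using k(1) by (rule relpowp_Suc_I2)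
    moreover have "Suc k \<le> (\<Sum>(x, y)\<in>R j. N - h y)"
      using k(2) \<open>(\<Sum>(x, y)\<in>R2 j. N - h y) < (\<Sum>(x, y)\<in>R j. N - h y)\<close> by linarith
    ultimately show ?thesis using T' t2 by metis
  qed
qed

lemma (in schnyder_wood) card_label: "card (R j) \<le> card (verts T)"
proof -
  have "inj_on fst (R j)" using out_unique by (auto simp: inj_on_def)
  moreover have "fst ` R j \<subseteq> verts T" using labelled_dart dart_verts by fastforce
  ultimately show ?thesis using finite_verts by (meson card_inj_on_le)
qed

lemma reach_star:
  assumes T: "triangulation T" and R: "schnyder_wood T R"
  shows "\<exists>T' R' k. (flip_step ^^ k) (T, R) (T', R') \<and> k \<le> (card (verts T))\<^sup>2 \<and>
    triangulation T' \<and> schnyder_wood T' R' \<and> star (R' j) (root T' j) \<and>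
    verts T' = verts T \<and> root T' = root T \<and> R' (j + 1) = R (j + 1)"
proof -
  interpret schnyder_wood T R by (rule R)
  let ?n = "card (verts T)"
  obtain h where h: "height_function R j h" "\<forall>x. h x \<le> ?n" using height_function_exists by blast
  \<comment> \<open>At most \<open>?n\<close> edges have label \<open>j\<close>, and each
    contributes at most \<open>?n\<close>.\<close>
  have "(\<Sum>(x, y)\<in>R j. ?n - h y) \<le> (\<Sum>e\<in>R j. ?n)" by (rule sum_mono) auto
  also have "\<dots> \<le> ?n * ?n" using card_label by simp
  finally have "(\<Sum>(x, y)\<in>R j. ?n - h y) \<le> ?n\<^sup>2" by (simp add: power2_eq_square)
  then show ?thesis using raise_to_star[OF T R h] by (meson order_trans)
qed

section \<open>Uniqueness of the realizer with two stars\<close>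

lemma downward_closed_eq_lessThan:
  fixes A :: "nat set"
  assumes "finite A" "\<And>k. Suc k \<in> A \<Longrightarrow> k \<in> A"
  shows "A = {..<card A}"
proof -
  have down: "b \<in> A" if "a \<in> A" "b \<le> a" for a b
    using that(2,1) by (induction rule: inc_induct) (use assms(2) in auto)
  have "A \<subseteq> {..<card A}"
  proof
    fix a assume "a \<in> A"
    then have "{..a} \<subseteq> A" using down by auto
    then have "card {..a} \<le> card A" using assms(1) by (rule card_mono[rotated])
    then show "a \<in> {..<card A}" by simp
  qed
  then show ?thesis by (intro card_subset_eq) auto
qed

locale star_wood = schnyder_wood T R for T :: "'v outer_map" and R +
  assumes triangulation: "triangulation T"
    and star0: "star (R 0) (root T 0)"
    and star2: "star (R 2) (root T 2)"
begin

lemma no_incoming: "u \<in> inner_verts T \<Longrightarrow> (x, u) \<notin> R 0" "u \<in> inner_verts T \<Longrightarrow> (x, u) \<notin> R 2"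
  using star0 star2 root_not_inner unfolding star_def by blast+

text \<open>Inner vertices receive only label 1, so an edge between siblings would make one the
  parent of the other, but their parent is \<open>u\<close>.\<close>

lemma siblings_not_adjacent: "(x, u) \<in> R 1 \<Longrightarrow> (y, u) \<in> R 1 \<Longrightarrow> (x, y) \<notin> darts T"
proof
  assume x: "(x, u) \<in> R 1" and y: "(y, u) \<in> R 1" and d: "(x, y) \<in> darts T"
  note inner = labelled_inner[OF x] labelled_inner[OF y]
  obtain k where k: "(x, y) \<in> R k \<or> (y, x) \<in> R k" using label_exists[OF d inner(1)] by blast
  then have "k = 1" using label_exhaust[of k] no_incoming inner by blast
  then show False using k out_unique[OF x, of y] out_unique[OF y, of x] x y by auto
qed

lemma root_label: "(x, root T i) \<in> darts T \<Longrightarrow> x \<in> inner_verts T \<Longrightarrow> (x, root T i) \<in> R i"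
proof -
  assume d: "(x, root T i) \<in> darts T" and x: "x \<in> inner_verts T"
  obtain k where k: "(x, root T i) \<in> R k \<or> (root T i, x) \<in> R k" using label_exists[OF d x] by blast
  then have k: "(x, root T i) \<in> R k" using labelled_inner root_not_inner by blast
  then have "i = k" using root_target root_not_inner inj_root by (metis injD)
  then show ?thesis using k by simp
qed

text \<open>This turns the tree of label 1 into a path: all children of \<open>u\<close> have the
  same successor, and the rotation is injective. The successor is adjacent to \<open>x\<close>, so
  it is not a second child, and the rules exclude the rest.\<close>

lemma rot_child: 
  assumes x: "(x, u) \<in> R 1"
  shows "rot T u x = root T 0"
proof -
  let ?y = "rot T u x"
  note ux = labelled_dart'[OF x]
  note d = triangle(3-6)[OF ux]
  show ?thesis
  proof (cases "u \<in> inner_verts T")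
    case True
    have "(?y, u) \<notin> R 1" using siblings_not_adjacent[OF x] d by blast
    then show ?thesis using succ_in[OF x True] star0 by (auto simp: star_def)
  next
    case False
    then have u: "u = root T 1" using root_target[OF x] by blast
    have "?y \<notin> inner_verts T"
    proof
      assume "?y \<in> inner_verts T"
      then have "(?y, u) \<in> R 1" using root_label[of ?y 1] d u by simp
      then show False using siblings_not_adjacent[OF x] d by blast
    qed
    moreover have "?y \<in> verts T" using d dart_verts by blast
    ultimately obtain k where k: "?y = root T k" by (auto simp: inner_verts_def)
    have "k \<noteq> 1" using k u d dart_irrefl by metis
    moreover have "k \<noteq> 2"
    proof
      assume "k = 2"
      then have xy: "(x, ?y) \<in> R 2" using root_label[of x 2] d(2) k labelled_inner[OF x] by simp
      have "rot T x ?y = u" using triangle(2)[OF ux] .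
      then have "(x, u) \<in> R (2 + 1) \<or> (u, x) \<in> R (2 - 1)" using succ_out[OF xy] by auto
      then show False using label_asym[OF x] label_unique[OF x, of 0] by (auto simp: label_numerals)
    qed
    ultimately show ?thesis using label_exhaust[of k] k by auto
  qed
qed

lemma in_unique: "(x, u) \<in> R 1 \<Longrightarrow> (y, u) \<in> R 1 \<Longrightarrow> x = y"
  using rot_inj[OF labelled_dart' labelled_dart'] rot_child by metis

text \<open>Makes the labels determine the rotation at an inner vertex: the three outgoing edges in
  order, then the single child if there is one.\<close>

lemma rot_inner:
  assumes u: "u \<in> inner_verts T"
  shows "(u, y) \<in> R 0 \<Longrightarrow> (u, rot T u y) \<in> R 1"
    and "(u, y) \<in> R 1 \<Longrightarrow> (u, rot T u y) \<in> R 2"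
    and "(y, u) \<in> R 1 \<Longrightarrow> (u, rot T u y) \<in> R 0"
    and "(u, y) \<in> R 2 \<Longrightarrow> (t, u) \<in> R 1 \<Longrightarrow> rot T u y = t"
    and "(u, y) \<in> R 2 \<Longrightarrow> (\<And>t. (t, u) \<notin> R 1) \<Longrightarrow> (u, rot T u y) \<in> R 0"
proof -
  show "(u, y) \<in> R 0 \<Longrightarrow> (u, rot T u y) \<in> R 1"
    using succ_out[of u y 0] no_incoming[OF u] by (auto simp: label_numerals)
  show "(u, y) \<in> R 1 \<Longrightarrow> (u, rot T u y) \<in> R 2"
    using succ_out[of u y 1] no_incoming[OF u] by auto
  show child: "(y, u) \<in> R 1 \<Longrightarrow> (u, rot T u y) \<in> R 0" for y
    using rot_child[of y u] rot_dart[of u y] labelled_dart'[of y u 1] root_label[of u 0] u by simp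
  show "rot T u y = t" if uy: "(u, y) \<in> R 2" and t: "(t, u) \<in> R 1"
  proof -
    obtain p where p: "(u, p) \<in> darts T" "rot T u p = t" using rot_surj[OF labelled_dart'[OF t]] by blast
    then have "(p, u) \<in> R 1 \<or> (u, p) \<in> R 2" using pred_in[of u p 1] t u by auto
    moreover have "(p, u) \<notin> R 1" using child[of p] label_asym[OF t] p by auto
    ultimately show ?thesis using out_unique[OF uy] p by blast
  qed
  show "(u, y) \<in> R 2 \<Longrightarrow> (\<And>t. (t, u) \<notin> R 1) \<Longrightarrow> (u, rot T u y) \<in> R 0"
    using succ_out[of u y 2] by (auto simp: label_numerals)
qed

definition path_verts :: "'v set" where
  "path_verts = verts T - {root T 0, root T 2}"

text \<open>Meaningful on \<open>path_verts\<close> only: no path of label 1 leads from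
  \<open>root T 0\<close> or \<open>root T 2\<close> to \<open>root T 1\<close>, so there
  \<open>LEAST\<close> has no number to choose from.\<close>

definition depth :: "'v \<Rightarrow> nat" where
  "depth x = (LEAST k. (x, root T 1) \<in> R 1 ^^ k)"

lemma root_in_verts: "root T i \<in> verts T"
  using triangulation_props(2)[OF triangulation] by auto

lemma root_eq_iff [simp]: "root T i = root T k \<longleftrightarrow> i = k"
  using inj_root by (auto dest: injD)

lemma path_verts_iff: "x \<in> path_verts \<longleftrightarrow> x \<in> inner_verts T \<or> x = root T 1"
proof -
  have "(UNIV :: 3 set) = {0, 1, 2}" using label_exhaust by blast
  then have "range (root T) = {root T 0, root T 1, root T 2}" by (metis image_empty image_insert)
  then show ?thesis using root_in_verts by (auto simp: path_verts_def inner_verts_def)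
qed

lemma card_path_verts: "card path_verts = card (verts T) - 2"
  unfolding path_verts_def using root_in_verts finite_verts by (subst card_Diff_subset) auto

lemma target_path: "(x, y) \<in> R 1 \<Longrightarrow> y \<in> path_verts"
  using root_target path_verts_iff by blast

lemma depth_root: "depth (root T 1) = 0"
  unfolding depth_def by (rule Least_eq_0) simp

lemma depth_Suc:
  assumes xy: "(x, y) \<in> R 1"
  shows "depth x = Suc (depth y)"
proof -
  have "(x, root T 1) \<in> (R 1)\<^sup>*" using tree[of 1] xy unfolding tree_towards_def Field_def by blast
  then obtain n where n: "(x, root T 1) \<in> R 1 ^^ n" using rtrancl_imp_relpow by blast
  have "(x, root T 1) \<notin> R 1 ^^ 0" using labelled_inner[OF xy] root_not_inner by auto
  moreover have "(x, root T 1) \<in> R 1 ^^ Suc m \<longleftrightarrow> (y, root T 1) \<in> R 1 ^^ m" for m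
    using relpow_Suc_I2[OF xy] relpow_Suc_E2 out_unique[OF xy] by metis
  ultimately show ?thesis
    unfolding depth_def using Least_Suc[of "\<lambda>k. (x, root T 1) \<in> R 1 ^^ k" n] n by simp
qed

text \<open>Vertices of equal positive depth have the same parent by induction, and a parent has
  only one child.\<close>

lemma inj_depth: "inj_on depth path_verts"
proof (rule inj_onI)
  fix x y assume "x \<in> path_verts" "y \<in> path_verts" "depth x = depth y"
  then show "x = y"
  proof (induction "depth x" arbitrary: x y rule: less_induct)
    case less
    show ?case
    proof (cases "x \<in> inner_verts T \<and> y \<in> inner_verts T")
      case True
      then obtain x' y' where xy: "(x, x') \<in> R 1" "(y, y') \<in> R 1" using out_exists by metis
      then have "x' = y'"
        using less.hyps[of x' y'] less.prems target_path depth_Suc[OF xy(1)] depth_Suc[OF xy(2)] by auto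
      then show ?thesis using xy in_unique by blast
    next
      case False
      have "depth t \<noteq> 0" if t: "t \<in> inner_verts T" for t
        using out_exists[OF t, of 1] depth_Suc by fastforce
      then show ?thesis using False less.prems depth_root path_verts_iff by metis
    qed
  qed
qed

lemma depth_image: "depth ` path_verts = {..<card (verts T) - 2}"
proof -
  have fin: "finite path_verts" using finite_verts by (simp add: path_verts_def)
  have "depth ` path_verts = {..<card (depth ` path_verts)}"
  proof (rule downward_closed_eq_lessThan)
    show "finite (depth ` path_verts)" using fin by simp
    fix k assume "Suc k \<in> depth ` path_verts"
    then obtain x where x: "x \<in> path_verts" "depth x = Suc k" by auto
    then have "x \<in> inner_verts T" using path_verts_iff depth_root by auto
    then obtain y where y: "(x, y) \<in> R 1" using out_exists by blast
    then show "k \<in> depth ` path_verts" using depth_Suc[OF y] x target_path[OF y] by auto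
  qed
  then show ?thesis using card_image[OF inj_depth] card_path_verts by simp
qed

lemma label1_iff: "(x, y) \<in> R 1 \<longleftrightarrow> x \<in> inner_verts T \<and> y \<in> path_verts \<and> depth x = Suc (depth y)"
proof
  show "x \<in> inner_verts T \<and> y \<in> path_verts \<and> depth x = Suc (depth y)" if "(x, y) \<in> R 1"
    using that labelled_inner target_path depth_Suc by blast
  assume x: "x \<in> inner_verts T \<and> y \<in> path_verts \<and> depth x = Suc (depth y)"
  then obtain t where t: "(x, t) \<in> R 1" using out_exists by blast
  then have "depth t = depth y" using depth_Suc[OF t] x by simp
  then show "(x, y) \<in> R 1" using t inj_onD[OF inj_depth] target_path x by metis
qed

lemma label0_iff: "(x, y) \<in> R 0 \<longleftrightarrow> x \<in> inner_verts T \<and> y = root T 0"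
  using star0 labelled_inner out_exists unfolding star_def by metis

lemma label2_iff: "(x, y) \<in> R 2 \<longleftrightarrow> x \<in> inner_verts T \<and> y = root T 2"
  using star2 labelled_inner out_exists unfolding star_def by metis

lemma dart_iff:
  assumes "x \<in> verts T" "y \<in> verts T"
  shows "(x, y) \<in> darts T \<longleftrightarrow> (\<exists>i. (x, y) \<in> R i \<or> (y, x) \<in> R i) \<or>
    x \<notin> inner_verts T \<and> y \<notin> inner_verts T \<and> x \<noteq> y"
proof
  assume d: "(x, y) \<in> darts T"
  then have "x \<noteq> y" using dart_irrefl by blast
  then show "(\<exists>i. (x, y) \<in> R i \<or> (y, x) \<in> R i) \<or> x \<notin> inner_verts T \<and> y \<notin> inner_verts T \<and> x \<noteq> y"
    using label_exists d dart_sym by blast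
next
  assume r: "(\<exists>i. (x, y) \<in> R i \<or> (y, x) \<in> R i) \<or> x \<notin> inner_verts T \<and> y \<notin> inner_verts T \<and> x \<noteq> y"
  show "(x, y) \<in> darts T"
  proof (cases "\<exists>i. (x, y) \<in> R i \<or> (y, x) \<in> R i")
    case True
    then show ?thesis using labelled_dart labelled_dart' by blast
  next
    case False
    then obtain i k where "x = root T i" "y = root T k" "i \<noteq> k"
      using r assms by (auto simp: inner_verts_def)
    then show ?thesis using triangulation_roots(2)[OF triangulation] by blast
  qed
qed

end

text \<open>The map matches roots and depths, and these determine all labels. The labels fix the
  rotation at inner vertices; at a root it is recovered from an inner corner of the same
  face.\<close>

lemma star_wood_iso:
  assumes "star_wood T R" "star_wood T' R'" and card: "card (verts T) = card (verts T')"
  shows "\<exists>f. realizer_iso f (T, R) (T', R')"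
proof -
  interpret A: star_wood T R by fact
  interpret B: star_wood T' R' by fact
  define g where "g = inv_into B.path_verts B.depth"
  define f where "f x = (if x = root T 0 then root T' 0 else if x = root T 2 then root T' 2
    else g (A.depth x))" for x
  have bijA: "bij_betw A.depth A.path_verts {..<card (verts T) - 2}"
    using A.inj_depth A.depth_image by (simp add: bij_betw_def)
  have bijB: "bij_betw B.depth B.path_verts {..<card (verts T) - 2}"
    using B.inj_depth B.depth_image card by (simp add: bij_betw_def)
  have bij: "bij_betw (g \<circ> A.depth) A.path_verts B.path_verts"
    unfolding g_def by (rule bij_betw_trans[OF bijA bij_betw_inv_into[OF bijB]])
  have fpath: "f x = g (A.depth x)" if "x \<in> A.path_verts" for x
    using that by (auto simp: f_def A.path_verts_def)
  have f_in: "f x \<in> B.path_verts" if "x \<in> A.path_verts" for x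
    using bij that fpath by (auto simp: bij_betw_def)
  have depth_f: "B.depth (f x) = A.depth x" if x: "x \<in> A.path_verts" for x
  proof -
    have "A.depth x \<in> B.depth ` B.path_verts" using A.depth_image B.depth_image card x by auto
    then show ?thesis using fpath[OF x] by (simp add: g_def f_inv_into_f)
  qed
  have "f (root T 1) \<in> B.path_verts" "B.depth (f (root T 1)) = B.depth (root T' 1)"
    using f_in depth_f A.path_verts_iff A.depth_root B.depth_root by auto
  then have "f (root T 1) = root T' 1" using B.inj_depth B.path_verts_iff by (auto dest: inj_onD)
  then have f_root: "f (root T i) = root T' i" for i
    using label_exhaust[of i] by (auto simp: f_def)
  have "bij_betw f A.path_verts B.path_verts" using bij fpath by (simp cong: bij_betw_cong)
  moreover have "bij_betw f {root T 0, root T 2} {root T' 0, root T' 2}"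
    by (auto simp: bij_betw_def inj_on_def f_root)
  ultimately have "bij_betw f (A.path_verts \<union> {root T 0, root T 2}) (B.path_verts \<union> {root T' 0, root T' 2})"
    by (rule bij_betw_combine) (auto simp: B.path_verts_def)
  moreover have "A.path_verts \<union> {root T 0, root T 2} = verts T" "B.path_verts \<union> {root T' 0, root T' 2} = verts T'"
    using A.root_in_verts B.root_in_verts by (auto simp: A.path_verts_def B.path_verts_def)
  ultimately have f: "bij_betw f (verts T) (verts T')" by simp
  have f_eq: "f x = f y \<longleftrightarrow> x = y" if "x \<in> verts T" "y \<in> verts T" for x y
    using f that by (auto simp: bij_betw_def dest: inj_onD)
  have f_root_iff: "f x = root T' i \<longleftrightarrow> x = root T i" if "x \<in> verts T" for x i
    using f_eq[OF that A.root_in_verts] f_root by metis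
  have f_verts: "f x \<in> verts T'" if "x \<in> verts T" for x
    using f that by (auto simp: bij_betw_def)
  have f_inner: "f x \<in> inner_verts T' \<longleftrightarrow> x \<in> inner_verts T" if "x \<in> verts T" for x
    using that f_verts[OF that] f_root_iff[OF that] unfolding inner_verts_def by fastforce
  have f_path: "f x \<in> B.path_verts \<longleftrightarrow> x \<in> A.path_verts" if "x \<in> verts T" for x
    using f_inner f_root_iff that by (simp add: A.path_verts_iff B.path_verts_iff)
  have f_label: "(f x, f y) \<in> R' i \<longleftrightarrow> (x, y) \<in> R i" if v: "x \<in> verts T" "y \<in> verts T" for x y i
  proof -
    consider "i = 0" | "i = 1" | "i = 2" using label_exhaust by blast
    then show ?thesis
    proof cases
      case 2
      then show ?thesis
        using v f_inner f_path depth_f A.path_verts_iff unfolding 2 A.label1_iff B.label1_iff by metis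
    qed (use v f_inner f_root_iff in \<open>simp_all add: A.label0_iff B.label0_iff A.label2_iff B.label2_iff\<close>)
  qed
  have f_dart: "(f x, f y) \<in> darts T' \<longleftrightarrow> (x, y) \<in> darts T" if v: "x \<in> verts T" "y \<in> verts T" for x y
    using v by (simp add: A.dart_iff B.dart_iff f_verts f_label f_inner f_eq)
  have f_rot_inner: "f (rot T x y) = rot T' (f x) (f y)"
    if x: "x \<in> inner_verts T" and xy: "(x, y) \<in> darts T" for x y
  proof -
    have V: "x \<in> verts T" "y \<in> verts T" "rot T x y \<in> verts T"
      using A.dart_verts xy A.rot_dart by blast+
    have fx: "f x \<in> inner_verts T'" using f_inner V x by simp
    obtain i where i: "(x, y) \<in> R i \<or> (y, x) \<in> R i" using A.label_exists[OF xy x] by blast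
    consider "(x, y) \<in> R 0" | "(x, y) \<in> R 1" | "(y, x) \<in> R 1" | "(x, y) \<in> R 2"
      using i label_exhaust[of i] A.no_incoming[OF x] by blast
    then show ?thesis
    proof cases
      case 1
      then show ?thesis
        using A.rot_inner(1)[OF x 1] B.rot_inner(1)[OF fx] B.out_unique f_label V by metis
    next
      case 2
      then show ?thesis
        using A.rot_inner(2)[OF x 2] B.rot_inner(2)[OF fx] B.out_unique f_label V by metis
    next
      case 3
      then show ?thesis
        using A.rot_inner(3)[OF x 3] B.rot_inner(3)[OF fx] B.out_unique f_label V by metis
    next
      case 4
      then have y': "(f x, f y) \<in> R' 2" using f_label V by simp
      show ?thesis
      proof (cases "\<exists>t. (t, x) \<in> R 1")
        case True
        then obtain t where t: "(t, x) \<in> R 1" by blast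
        then have "t \<in> verts T" using A.labelled_dart A.dart_verts by blast
        then have "(f t, f x) \<in> R' 1" using t f_label V by simp
        then show ?thesis using A.rot_inner(4)[OF x 4 t] B.rot_inner(4)[OF fx y'] by simp
      next
        case False
        have "(t', f x) \<notin> R' 1" for t'
        proof
          assume t': "(t', f x) \<in> R' 1"
          then have "t' \<in> verts T'" using B.labelled_dart B.dart_verts by blast
          then obtain t where "t \<in> verts T" "t' = f t" using f by (auto simp: bij_betw_def)
          then show False using t' f_label V False by blast
        qed
        from B.rot_inner(5)[OF fx y' this] have "(f x, rot T' (f x) (f y)) \<in> R' 0" .
        moreover have "(f x, f (rot T x y)) \<in> R' 0"
          using A.rot_inner(5)[OF x 4] False f_label V by blast
        ultimately show ?thesis using B.out_unique by blast
      qed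
    qed
  qed
  have f_rot: "f (rot T b a) = rot T' (f b) (f a)" if ba: "(b, a) \<in> darts T" for a b
  proof -
    define c where "c = rot T b a"
    note tri = A.triangle[OF ba, folded c_def]
    have V: "a \<in> verts T" "b \<in> verts T" "c \<in> verts T" using A.dart_verts ba tri by blast+
    have fD: "(f a, f c) \<in> darts T'" "(f c, f b) \<in> darts T'" "(f b, f a) \<in> darts T'" "(f b, f c) \<in> darts T'"
      using f_dart V tri ba by auto
    consider "b \<in> inner_verts T" | "a \<in> inner_verts T" | "c \<in> inner_verts T"
      | (roots) "b \<notin> inner_verts T" "a \<notin> inner_verts T" "c \<notin> inner_verts T" by blast
    then have "f c = rot T' (f b) (f a)"
    proof cases
      case 1
      then show ?thesis using f_rot_inner[OF 1 ba] by (simp add: c_def)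
    next
      case 2
      then have "rot T' (f a) (f c) = f b" using f_rot_inner[OF 2 tri(4)] tri(2) by simp
      then show ?thesis using B.triangle(1)[OF fD(1)] by simp
    next
      case 3
      then have "rot T' (f c) (f b) = f a" using f_rot_inner[OF 3 tri(6)] tri(1) by simp
      then show ?thesis using B.triangle(2)[OF fD(2)] by simp
    next
      case roots
      \<comment> \<open>A face with three roots has no inner corner. The third vertex
        \<open>c'\<close> of the image face is not the image of an inner vertex \<open>e\<close>,
        for the rotation at \<open>e\<close> would already force \<open>c = e\<close>. So
        \<open>c'\<close> is the third root.\<close>
      define c' where "c' = rot T' (f b) (f a)"
      note tri' = B.triangle[OF fD(3), folded c'_def]
      have c'V: "c' \<in> verts T'" using B.dart_verts tri' by blast
      then obtain e where e: "e \<in> verts T" "c' = f e" using f by (auto simp: bij_betw_def)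
      have "e \<notin> inner_verts T"
      proof
        assume inner: "e \<in> inner_verts T"
        have eb: "(e, b) \<in> darts T" using tri'(6) e f_dart V by blast
        then have "f (rot T e b) = f a" using f_rot_inner[OF inner eb] tri'(1) e by simp
        moreover have "rot T e b \<in> verts T" using A.rot_dart[OF eb] A.dart_verts by blast
        ultimately have "rot T e b = a" using f_eq V by blast
        then have "c = e" using A.triangle(2)[OF eb] by (simp add: c_def)
        then show False using inner roots by simp
      qed
      then obtain ka kb kc ke where k: "a = root T ka" "b = root T kb" "c = root T kc" "e = root T ke"
        using roots V e by (auto simp: inner_verts_def)
      have "ka \<noteq> kb" "kc \<noteq> ka" "kc \<noteq> kb" using k ba tri A.dart_irrefl by metis+
      moreover have "ke \<noteq> ka" "ke \<noteq> kb" using k tri' e B.dart_irrefl by metis+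
      ultimately have "kc = ke"
        using label_cases[of kb ka] label_cases[of kc ka] label_cases[of ke ka] by auto
      then show ?thesis using k e by (simp add: c'_def)
    qed
    then show ?thesis by (simp add: c_def)
  qed
  have "realizer_iso f (T, R) (T', R')"
    unfolding realizer_iso_def prod.case using f f_dart f_rot f_root f_label by blast
  then show ?thesis by blast
qed

section \<open>Distances in the flip graph\<close>

lemma star_wood_reachable:
  assumes T: "triangulation T" and R: "realizer T R"
  shows "\<exists>T' R' k. (flip_step ^^ k) (T, R) (T', R') \<and> k \<le> 2 * (card (verts T))\<^sup>2 \<and>
    star_wood T' R' \<and> card (verts T') = card (verts T)"
proof -
  obtain T1 R1 k1 where 1: "(flip_step ^^ k1) (T, R) (T1, R1)" "k1 \<le> (card (verts T))\<^sup>2"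
    "triangulation T1" "schnyder_wood T1 R1" "star (R1 0) (root T1 0)" "verts T1 = verts T"
    using reach_star[OF T realizer_schnyder_wood[OF T R], of 0] by blast
  obtain T2 R2 k2 where 2: "(flip_step ^^ k2) (T1, R1) (T2, R2)" "k2 \<le> (card (verts T1))\<^sup>2"
    "triangulation T2" "schnyder_wood T2 R2" "star (R2 2) (root T2 2)" "verts T2 = verts T1"
    "root T2 = root T1" "R2 (2 + 1) = R1 (2 + 1)"
    using reach_star[OF 1(3,4), of 2] by blast
  \<comment> \<open>Modulo 3, \<open>2 + 1\<close> is the label 0, which the second sweep
    keeps.\<close>
  have "star (R2 0) (root T2 0)" using 1(5) 2(7,8) by (simp add: label_numerals)
  then have "star_wood T2 R2" using 2 by (simp add: star_wood_def star_wood_axioms_def)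
  moreover have "(flip_step ^^ (k1 + k2)) (T, R) (T2, R2)" using 1(1) 2(1) by (rule relpowp_trans)
  ultimately show ?thesis using 1 2 by (intro exI[of _ T2] exI[of _ R2] exI[of _ "k1 + k2"]) auto
qed

lemma flip_step_adj:
  assumes P: "P \<in> realizer_set n" and PQ: "flip_step P Q"
  shows "Q \<in> realizer_set n" "(iso_rel n `` {P}, iso_rel n `` {Q}) \<in> flip_graph_adj n"
proof -
  show Q: "Q \<in> realizer_set n"
    using P PQ by (cases P; cases Q) (auto simp: realizer_set_def flip_step_def colored_flip_def)
  have "P \<in> iso_rel n `` {P}" "Q \<in> iso_rel n `` {Q}" using equiv_iso_rel P Q by (meson equiv_class_self)+
  moreover have "iso_rel n `` {P} \<in> flip_graph_verts n" "iso_rel n `` {Q} \<in> flip_graph_verts n"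
    using P Q by (auto simp: flip_graph_verts_def quotientI)
  moreover have "colored_flip P Q" using PQ by (simp add: flip_step_def)
  ultimately show "(iso_rel n `` {P}, iso_rel n `` {Q}) \<in> flip_graph_adj n"
    unfolding flip_graph_adj_def by blast
qed

lemma flip_steps_adj:
  assumes "(flip_step ^^ k) P Q" "P \<in> realizer_set n"
  shows "Q \<in> realizer_set n \<and> (iso_rel n `` {P}, iso_rel n `` {Q}) \<in> flip_graph_adj n ^^ k"
  using assms
proof (induction k arbitrary: Q)
  case (Suc k)
  then obtain M where M: "(flip_step ^^ k) P M" "flip_step M Q" by (auto elim: relpowp_Suc_E)
  then show ?case using Suc flip_step_adj[of M n Q] relpow_Suc_I by metis
qed simp

lemma sym_relpow: "sym r \<Longrightarrow> (x, y) \<in> r ^^ k \<Longrightarrow> (y, x) \<in> r ^^ k"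
proof (induction k arbitrary: y)
  case (Suc k)
  then obtain m where "(x, m) \<in> r ^^ k" "(m, y) \<in> r" by (auto elim: relpow_Suc_E)
  then show ?case using Suc by (meson relpow_Suc_I2 symD)
qed simp

lemma flip_graph_adj_sym: "sym (flip_graph_adj n)"
  unfolding flip_graph_adj_def sym_def by blast

theorem theorem2:
  shows "\<exists>c::nat. \<forall>n\<ge>4. \<forall>X\<in>flip_graph_verts n. \<forall>Y\<in>flip_graph_verts n.
           flip_dist n X Y \<le> enat (c * n^2)"
proof (intro exI[of _ 4] allI ballI impI)
  fix n :: nat and X Y
  assume X: "X \<in> flip_graph_verts n" and Y: "Y \<in> flip_graph_verts n"
  have star: "\<exists>T R k. star_wood T R \<and> (T, R) \<in> realizer_set n \<and> k \<le> 2 * n\<^sup>2 \<and>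
      (Z, iso_rel n `` {(T, R)}) \<in> flip_graph_adj n ^^ k" if Z: "Z \<in> flip_graph_verts n" for Z
  proof -
    obtain P where P: "P \<in> realizer_set n" "Z = iso_rel n `` {P}"
      using Z unfolding flip_graph_verts_def by (auto elim: quotientE)
    obtain T R where TR: "P = (T, R)" by (cases P)
    then have "triangulation T" "realizer T R" "card (verts T) = n" using P by (auto simp: realizer_set_def)
    then obtain T' R' k where "(flip_step ^^ k) (T, R) (T', R')" "k \<le> 2 * n\<^sup>2" "star_wood T' R'"
      using star_wood_reachable by metis
    then show ?thesis using flip_steps_adj P TR by metis
  qed
  obtain T R k where 1: "star_wood T R" "(T, R) \<in> realizer_set n" "k \<le> 2 * n\<^sup>2"
    "(X, iso_rel n `` {(T, R)}) \<in> flip_graph_adj n ^^ k" using star[OF X] by blast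
  obtain T' R' k' where 2: "star_wood T' R'" "(T', R') \<in> realizer_set n" "k' \<le> 2 * n\<^sup>2"
    "(Y, iso_rel n `` {(T', R')}) \<in> flip_graph_adj n ^^ k'" using star[OF Y] by blast
  have "card (verts T) = card (verts T')" using 1 2 by (simp add: realizer_set_def)
  from star_wood_iso[OF 1(1) 2(1) this]
  have "((T, R), (T', R')) \<in> iso_rel n" using 1 2 by (simp add: iso_rel_def)
  then have "iso_rel n `` {(T, R)} = iso_rel n `` {(T', R')}"
    using equiv_class_eq[OF equiv_iso_rel] by blast
  then have "(X, Y) \<in> flip_graph_adj n ^^ (k + k')"
    using 1(4) sym_relpow[OF flip_graph_adj_sym 2(4)] by (auto simp: relpow_add)
  then have "flip_dist n X Y \<le> enat (k + k')"
    unfolding flip_dist_def by (intro INF_lower) simp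
  \<comment> \<open>Each of the two walks consists of two sweeps of at most \<open>n\<^sup>2\<close>
    flips.\<close>
  also have "\<dots> \<le> enat (4 * n\<^sup>2)" using 1(3) 2(3) by simp
  finally show "flip_dist n X Y \<le> enat (4 * n^2)" .
qed

end
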